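(* For all integers $m\ge 1$, $s\ge 2$, $k\ge 3$, every $\{P_k,\overline{mK_s}\}$-free graph $G$ satisfies \[\chi(G)< (2s^{k-3})^{m-1}(4s+1)\cdot R(s,\omega(G)+1).\]
   Context: Graphs are finite and simple. $\chi(G)$ and $\omega(G)$ denote the chromatic number and clique number of $G$. A graph $G$ is $H$-free if it has no induced subgraph isomorphic to $H$, and $\mathcal H$-free (for a set $\mathcal H$ of graphs) if it is $H$-free for all $H\in\mathcal H$. $P_k$ is the path with $k$ vertices. $\overline{mK_s}$ is the complement of the disjoint union of $m$ copies of the complete graph $K_s$, i.e. the complete multipartite graph with $m$ parts, each of size $s$. $R(s,w)$ is the Ramsey number: the least integer $n\ge1$ such that every $n$-vertex graph has a stable (independent) set of size $s$ or a clique of size $w$. *)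

theory Defs
  imports "HOL-Library.Ramsey"
begin

text \<open>
  A graph is a pair of a vertex set and a set of edges, each edge being a two-element set of
  vertices; this is the edge representation used by \<^const>\<open>clique\<close> and \<^const>\<open>indep\<close>, whose
  first argument is a vertex set and whose second argument is the edge set.
\<close>

type_synonym 'a graph = "'a set \<times> 'a set set"

abbreviation verts :: "'a graph \<Rightarrow> 'a set" where
  "verts G \<equiv> fst G"

abbreviation edges :: "'a graph \<Rightarrow> 'a set set" where
  "edges G \<equiv> snd G"

definition fin_simple_graph :: "'a graph \<Rightarrow> bool" where
  "fin_simple_graph G \<longleftrightarrow> finite (verts G) \<and> edges G \<subseteq> [verts G]\<^bsup>2\<^esup>"

definition graph_iso :: "'a graph \<Rightarrow> 'b graph \<Rightarrow> bool" where
  "graph_iso G H \<longleftrightarrow>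
     (\<exists>f. bij_betw f (verts G) (verts H) \<and>
          (\<forall>u\<in>verts G. \<forall>v\<in>verts G. {u, v} \<in> edges G \<longleftrightarrow> {f u, f v} \<in> edges H))"

definition induced_subgraph :: "'a graph \<Rightarrow> 'a set \<Rightarrow> 'a graph" where
  "induced_subgraph G S = (S, edges G \<inter> [S]\<^bsup>2\<^esup>)"

definition is_free :: "'b graph \<Rightarrow> 'a graph \<Rightarrow> bool" where
  "is_free H G \<longleftrightarrow> \<not> (\<exists>S\<subseteq>verts G. graph_iso (induced_subgraph G S) H)"

definition path_graph :: "nat \<Rightarrow> nat graph" where
  "path_graph k = ({..<k}, {{i, Suc i} | i. Suc i < k})"

definition complete_graph :: "nat \<Rightarrow> nat graph" where
  "complete_graph s = ({..<s}, [{..<s}]\<^bsup>2\<^esup>)"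

definition disjoint_copies :: "nat \<Rightarrow> 'a graph \<Rightarrow> (nat \<times> 'a) graph" where
  "disjoint_copies m G = ({..<m} \<times> verts G, (\<Union>i<m. (\<lambda>e. Pair i ` e) ` edges G))"

definition complement :: "'a graph \<Rightarrow> 'a graph" where
  "complement G = (verts G, [verts G]\<^bsup>2\<^esup> - edges G)"

definition proper_colouring :: "'a graph \<Rightarrow> nat \<Rightarrow> ('a \<Rightarrow> nat) \<Rightarrow> bool" where
  "proper_colouring G n c \<longleftrightarrow>
     (\<forall>v\<in>verts G. c v < n) \<and> (\<forall>u v. {u, v} \<in> edges G \<longrightarrow> c u \<noteq> c v)"

definition chromatic_number :: "'a graph \<Rightarrow> nat" where
  "chromatic_number G = (LEAST n. \<exists>c. proper_colouring G n c)"

definition clique_number :: "'a graph \<Rightarrow> nat" where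
  "clique_number G = Max {card K | K. K \<subseteq> verts G \<and> clique K (edges G)}"

text \<open>
  Vertices of type \<^typ>\<open>nat\<close> are no restriction here, since every finite graph is isomorphic to
  one with natural numbers as vertices.
\<close>

definition ramsey_number :: "nat \<Rightarrow> nat \<Rightarrow> nat" where
  "ramsey_number s w =
     (LEAST n. n \<ge> 1 \<and>
        (\<forall>G :: nat graph. fin_simple_graph G \<and> card (verts G) = n \<longrightarrow>
           (\<exists>S\<subseteq>verts G. card S = s \<and> indep S (edges G)) \<or>
           (\<exists>K\<subseteq>verts G. card K = w \<and> clique K (edges G))))"

text \<open>The least elements and the maximum above exist.\<close>

lemma ramsey_number_works:
  "ramsey_number s w \<ge> 1 \<and>
     (\<forall>G :: nat graph. fin_simple_graph G \<and> card (verts G) = ramsey_number s w \<longrightarrow>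
        (\<exists>S\<subseteq>verts G. card S = s \<and> indep S (edges G)) \<or>
        (\<exists>K\<subseteq>verts G. card K = w \<and> clique K (edges G)))"
proof -
  obtain r where "r \<ge> 1" and r: "\<forall>(V::nat set) (E::nat set set). finite V \<and> card V \<ge> r \<longrightarrow>
      (\<exists>R\<subseteq>V. card R = w \<and> clique R E \<or> card R = s \<and> indep R E)"
    using ramsey2[of w s] by blast
  have "r \<ge> 1 \<and>
     (\<forall>G :: nat graph. fin_simple_graph G \<and> card (verts G) = r \<longrightarrow>
        (\<exists>S\<subseteq>verts G. card S = s \<and> indep S (edges G)) \<or>
        (\<exists>K\<subseteq>verts G. card K = w \<and> clique K (edges G)))"
    using \<open>r \<ge> 1\<close> r unfolding fin_simple_graph_def by (metis order_refl)
  then show ?thesis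
    unfolding ramsey_number_def by (rule LeastI)
qed

lemma chromatic_number_works:
  assumes "fin_simple_graph G"
  shows "\<exists>c. proper_colouring G (chromatic_number G) c"
proof -
  obtain c :: "'a \<Rightarrow> nat" where c: "bij_betw c (verts G) {0..<card (verts G)}"
    using assms ex_bij_betw_finite_nat unfolding fin_simple_graph_def by blast
  have "c u \<noteq> c v" if "{u, v} \<in> edges G" for u v
  proof -
    have "{u, v} \<in> [verts G]\<^bsup>2\<^esup>"
      using that assms unfolding fin_simple_graph_def by blast
    then have "u \<in> verts G" "v \<in> verts G" "u \<noteq> v"
      by auto
    then show ?thesis
      using c by (auto simp: bij_betw_def inj_on_def)
  qed
  moreover have "c v < card (verts G)" if "v \<in> verts G" for v
    using c that by (auto simp: bij_betw_def)
  ultimately have "\<exists>c. proper_colouring G (card (verts G)) c"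
    unfolding proper_colouring_def by blast
  then show ?thesis
    unfolding chromatic_number_def by (rule LeastI)
qed

lemma clique_number_works:
  assumes "fin_simple_graph G"
  shows "clique_number G \<in> {card K | K. K \<subseteq> verts G \<and> clique K (edges G)}"
    and "K \<subseteq> verts G \<Longrightarrow> clique K (edges G) \<Longrightarrow> card K \<le> clique_number G"
proof -
  let ?A = "{card K | K. K \<subseteq> verts G \<and> clique K (edges G)}"
  have "?A \<subseteq> card ` Pow (verts G)"
    by auto
  then have fin: "finite ?A"
    using assms by (auto simp: fin_simple_graph_def intro: finite_subset)
  have "card ({} :: 'a set) \<in> ?A"
    using null_clique by blast
  then show "clique_number G \<in> ?A"
    unfolding clique_number_def using fin by (metis (lifting) Max_in empty_iff)
  show "card K \<le> clique_number G" if "K \<subseteq> verts G" "clique K (edges G)"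
    unfolding clique_number_def using fin that by (intro Max_ge) auto
qed

end

(*
  Write r = R(s, omega + 1), so that every r vertices contain a stable s-set, and induct on m.
  The common neighbourhood of a stable s-set Y omits the complete multipartite graph with m - 1
  parts, so it is d-colourable by induction; hence if U needs more than d + s b colours, some y in
  Y has a set of non-neighbours in U needing more than b colours.

  This drives a Gyarfas path argument.  Neighbourhoods may have large chromatic number, so the next
  path vertex has to be chosen among at least r candidates, and the candidates must not be
  separable by few vertices from the part of the graph in which the path is to continue.  To ensure
  this, one passes at each step to an induced subgraph that stays connected after deleting any
  q = 3r - 3 vertices, at the price of 4q colours.  That such subgraphs exist is shown by extending
  partial colourings along small separators; vertices outside the uncoloured part with few
  neighbours in it are replaced by forbidden colours at these neighbours.
*)

theory Submission
  imports Defs "HOL-Number_Theory.Cong"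
begin

section \<open>Colourings, connectivity and linkedness of vertex sets\<close>

locale adjacency =
  fixes adj :: "'a \<Rightarrow> 'a \<Rightarrow> bool"
  assumes adj_sym: "adj u v \<Longrightarrow> adj v u"
    and adj_irrefl: "\<not> adj v v"
begin

definition nbr :: "'a \<Rightarrow> 'a set" where
  "nbr x = {v. adj x v}"

definition stable :: "'a set \<Rightarrow> bool" where
  "stable X \<longleftrightarrow> (\<forall>u\<in>X. \<forall>v\<in>X. \<not> adj u v)"

definition colourable :: "'a set \<Rightarrow> nat \<Rightarrow> bool" where
  "colourable X n \<longleftrightarrow>
     (\<exists>c. (\<forall>v\<in>X. c v < n) \<and> (\<forall>u\<in>X. \<forall>v\<in>X. adj u v \<longrightarrow> c u \<noteq> c v))"

definition conn :: "'a set \<Rightarrow> bool" where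
  "conn X \<longleftrightarrow> (\<forall>A\<subseteq>X. A \<noteq> {} \<longrightarrow> A \<noteq> X \<longrightarrow> (\<exists>a\<in>A. \<exists>b\<in>X - A. adj a b))"

text \<open>This is (q+1)-connectedness without the usual lower bound on the number of vertices:
  every clique, the empty set included, is linked for all \<open>q\<close>. Enough vertices are
  later obtained from non-colourability.\<close>

definition linked :: "nat \<Rightarrow> 'a set \<Rightarrow> bool" where
  "linked q X \<longleftrightarrow> (\<forall>S. finite S \<longrightarrow> card S \<le> q \<longrightarrow> conn (X - S))"

lemma mem_nbr [simp]: "v \<in> nbr x \<longleftrightarrow> adj x v"
  by (simp add: nbr_def)

lemma adj_commute: "adj u v \<longleftrightarrow> adj v u"
  using adj_sym by blast

lemma connD:
  assumes "conn X" "A \<subseteq> X" "a \<in> A" "b \<in> X" "b \<notin> A"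
  obtains u v where "u \<in> A" "v \<in> X" "v \<notin> A" "adj u v"
  using assms unfolding conn_def by blast

lemma colourable_mono: "colourable X m \<Longrightarrow> Y \<subseteq> X \<Longrightarrow> m \<le> n \<Longrightarrow> colourable Y n"
  unfolding colourable_def by (elim exE, rule exI, intro conjI) (auto dest: subsetD order_less_le_trans, blast)

lemma colourable_Un:
  assumes "colourable A m" "colourable B n"
  shows "colourable (A \<union> B) (m + n)"
proof -
  obtain f where f: "\<forall>v\<in>A. f v < m" "\<forall>u\<in>A. \<forall>v\<in>A. adj u v \<longrightarrow> f u \<noteq> f v"
    using assms(1) unfolding colourable_def by blast
  obtain g where g: "\<forall>v\<in>B. g v < n" "\<forall>u\<in>B. \<forall>v\<in>B. adj u v \<longrightarrow> g u \<noteq> g v"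
    using assms(2) unfolding colourable_def by blast
  define h where "h v = (if v \<in> A then f v else m + g v)" for v
  have "\<forall>v\<in>A \<union> B. h v < m + n"
    using f(1) g(1) by (auto simp: h_def trans_less_add1)
  moreover have "\<forall>u\<in>A \<union> B. \<forall>v\<in>A \<union> B. adj u v \<longrightarrow> h u \<noteq> h v"
  proof (intro ballI impI)
    fix u v assume "u \<in> A \<union> B" "v \<in> A \<union> B" "adj u v"
    then show "h u \<noteq> h v"
      using f g by (cases "u \<in> A"; cases "v \<in> A") (auto simp: h_def dest: bspec)
  qed
  ultimately show ?thesis
    unfolding colourable_def by blast
qed

lemma colourable_UN:
  assumes "finite Y" "\<And>y. y \<in> Y \<Longrightarrow> colourable (A y) b"
  shows "colourable (\<Union>y\<in>Y. A y) (card Y * b)"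
  using assms
proof (induction Y rule: finite_induct)
  case empty
  then show ?case by (simp add: colourable_def)
next
  case (insert y Y)
  then have "colourable (A y \<union> (\<Union>y\<in>Y. A y)) (b + card Y * b)"
    by (intro colourable_Un) auto
  then show ?case
    using insert by simp
qed

lemma colourable_card:
  assumes "finite X" "card X \<le> n"
  shows "colourable X n"
proof -
  obtain c :: "'a \<Rightarrow> nat" where c: "bij_betw c X {0..<card X}"
    using ex_bij_betw_finite_nat[OF assms(1)] by blast
  have "c v < n" if "v \<in> X" for v
    using bij_betwE[OF c] that assms(2) by fastforce
  moreover have "c u \<noteq> c v" if "u \<in> X" "v \<in> X" "adj u v" for u v
    using that c adj_irrefl by (metis bij_betw_inv_into_left)
  ultimately show ?thesis
    unfolding colourable_def by blast
qed

lemma linked_Diff: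
  assumes "linked q X" "finite T" "card T + p \<le> q"
  shows "linked p (X - T)"
  unfolding linked_def
proof (intro allI impI)
  fix S :: "'a set" assume S: "finite S" "card S \<le> p"
  have "card (T \<union> S) \<le> q"
    using card_Un_le[of T S] S assms by linarith
  then have "conn (X - (T \<union> S))"
    using assms S unfolding linked_def by blast
  then show "conn (X - T - S)"
    by (simp add: Diff_Diff_Int Diff_Un set_diff_eq conj_commute conj_left_commute)
qed

text \<open>Deleting at most \<open>q\<close> neighbours of \<open>y\<close> cannot isolate it. The
  bound on \<open>card U\<close> guarantees that another vertex would remain besides
  \<open>y\<close>.\<close>

lemma linked_degree:
  assumes "linked q U" "finite U" "y \<in> U" "q + 1 < card U"
  shows "q < card (nbr y \<inter> U)"
proof (rule ccontr)
  assume "\<not> q < card (nbr y \<inter> U)"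
  then have "conn (U - (nbr y \<inter> U))"
    using assms unfolding linked_def by auto
  moreover have "\<exists>b. b \<in> U - (nbr y \<inter> U) \<and> b \<notin> {y}"
  proof (rule ccontr)
    assume "\<not> ?thesis"
    then have "U \<subseteq> insert y (nbr y \<inter> U)" by auto
    then have "card U \<le> card (insert y (nbr y \<inter> U))"
      using assms(2) by (intro card_mono) auto
    also have "\<dots> \<le> Suc q"
      using \<open>\<not> q < card (nbr y \<inter> U)\<close> card_insert_le_m1 assms(2)
      by (metis Suc_le_mono card_insert_if finite_Int le_Suc_eq not_less)
    finally show False using assms(4) by simp
  qed
  then obtain b where "b \<in> U - (nbr y \<inter> U)" "b \<notin> {y}" by blast
  ultimately obtain u v where "u \<in> {y}" "v \<in> U - (nbr y \<inter> U)" "adj u v"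
    using assms(3) adj_irrefl connD[of "U - (nbr y \<inter> U)" "{y}" y b] by auto
  then show False by auto
qed

text \<open>Components can share colours, so one of them needs as many colours as \<open>E\<close>.
  It is found as a smallest union of components, expressed by \<open>Q\<close>, that is not
  \<open>n\<close>-colourable: a splitting without cross edges would give two smaller such unions,
  both colourable by minimality, and their colourings could be glued.\<close>

lemma component_not_colourable:
  assumes "finite E" "\<not> colourable E n"
  obtains D where "D \<subseteq> E" "conn D" "\<not> colourable D n" "\<And>u v. u \<in> D \<Longrightarrow> v \<in> E - D \<Longrightarrow> \<not> adj u v"
proof -
  define Q where "Q D \<longleftrightarrow> D \<subseteq> E \<and> \<not> colourable D n \<and> (\<forall>u\<in>D. \<forall>v\<in>E - D. \<not> adj u v)" for D
  have "Q E" using assms by (auto simp: Q_def)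
  then obtain D where D: "Q D" "\<And>D'. Q D' \<Longrightarrow> card D \<le> card D'"
    using ex_has_least_nat[of Q E card] by blast
  have "conn D"
    unfolding conn_def
  proof (intro allI impI, rule ccontr)
    fix A assume A: "A \<subseteq> D" "A \<noteq> {}" "A \<noteq> D" "\<not> (\<exists>a\<in>A. \<exists>b\<in>D - A. adj a b)"
    have fin: "finite D" using D(1) assms(1) finite_subset by (auto simp: Q_def)
    have less: "card A < card D" "card (D - A) < card D"
      using A fin by (auto intro!: psubset_card_mono)
    have "\<not> Q A" "\<not> Q (D - A)"
      using D(2) less by fastforce+
    moreover have "\<forall>u\<in>A. \<forall>v\<in>E - A. \<not> adj u v" "\<forall>u\<in>D - A. \<forall>v\<in>E - (D - A). \<not> adj u v"
      using D(1) A(1,4) adj_sym unfolding Q_def by blast+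
    ultimately have "colourable A n" "colourable (D - A) n"
      using D(1) A(1) unfolding Q_def by blast+
    then obtain f g where f: "\<forall>v\<in>A. f v < n" "\<forall>u\<in>A. \<forall>v\<in>A. adj u v \<longrightarrow> f u \<noteq> f v"
      and g: "\<forall>v\<in>D - A. g v < n" "\<forall>u\<in>D - A. \<forall>v\<in>D - A. adj u v \<longrightarrow> g u \<noteq> g v"
      unfolding colourable_def by (elim exE conjE) (rule that)
    define h where "h v = (if v \<in> A then f v else g v)" for v
    have "\<forall>v\<in>D. h v < n"
      using f(1) g(1) by (simp add: h_def)
    moreover have "\<forall>u\<in>D. \<forall>v\<in>D. adj u v \<longrightarrow> h u \<noteq> h v"
      using f(2) g(2) A(4) adj_sym unfolding h_def by (metis DiffI)
    ultimately have "colourable D n"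
      unfolding colourable_def by blast
    then show False using D(1) by (simp add: Q_def)
  qed
  then show ?thesis
    using that[of D] D(1) unfolding Q_def by blast
qed

text \<open>Greedy choice: each vertex has at least \<open>card X\<close> admissible colours, more
  than the earlier vertices have used up.\<close>

lemma distinct_list_colouring:
  fixes B :: "'a \<Rightarrow> nat set"
  assumes "finite X" "\<And>v. v \<in> X \<Longrightarrow> finite (B v)" "\<And>v. v \<in> X \<Longrightarrow> card (B v) + card X \<le> n"
  shows "\<exists>\<psi>. inj_on \<psi> X \<and> (\<forall>v\<in>X. \<psi> v < n \<and> \<psi> v \<notin> B v)"
  using assms
proof (induction X rule: finite_induct)
  case empty
  then show ?case by simp
next
  case (insert x X)
  have "\<And>v. v \<in> X \<Longrightarrow> card (B v) + card X \<le> n"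
    using insert.prems(2) insert.hyps by force
  then obtain \<psi> where \<psi>: "inj_on \<psi> X" "\<forall>v\<in>X. \<psi> v < n \<and> \<psi> v \<notin> B v"
    using insert.IH insert.prems(1) by auto
  have "card (B x \<union> \<psi> ` X) \<le> card (B x) + card X"
    by (meson card_Un_le card_image_le insert.hyps(1) le_trans add_left_mono)
  also have "\<dots> < n"
    using insert.prems(2)[of x] insert.hyps by simp
  finally have "\<not> {..<n} \<subseteq> B x \<union> \<psi> ` X"
    using insert.prems(1)[of x] insert.hyps(1)
    by (metis card_lessThan card_mono finite_UnI finite_imageI insertI1 linorder_not_less)
  then obtain a where a: "a < n" "a \<notin> B x" "a \<notin> \<psi> ` X" by auto
  have "inj_on (\<psi>(x := a)) (insert x X)"
    using \<psi>(1) a(3) insert.hyps(2) by (auto simp: inj_on_def)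
  moreover have "\<forall>v\<in>insert x X. (\<psi>(x := a)) v < n \<and> (\<psi>(x := a)) v \<notin> B v"
    using \<psi>(2) a insert.hyps(2) by auto
  ultimately show ?case by blast
qed

subsection \<open>Highly linked subgraphs of large chromatic number\<close>


text \<open>List colouring of \<open>D\<close> relative to a precoloured set \<open>Z\<close>. The
  precolouring \<open>c\<close> is arbitrary, so the vertices of a separator can be moved into
  \<open>Z\<close> without side conditions.\<close>

definition extension :: "nat \<Rightarrow> 'a set \<Rightarrow> 'a set \<Rightarrow> ('a \<Rightarrow> nat) \<Rightarrow> ('a \<Rightarrow> nat set) \<Rightarrow> ('a \<Rightarrow> nat) \<Rightarrow> bool" where
  "extension N D Z c F \<phi> \<longleftrightarrow>
     (\<forall>v\<in>D. \<phi> v < N \<and> \<phi> v \<notin> F v \<and> (\<forall>z\<in>Z. adj v z \<longrightarrow> \<phi> v \<noteq> c z)) \<and>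
     (\<forall>u\<in>D. \<forall>v\<in>D. adj u v \<longrightarrow> \<phi> u \<noteq> \<phi> v)"

lemma extensionI:
  assumes "\<And>v. v \<in> D \<Longrightarrow> \<phi> v < N" "\<And>v. v \<in> D \<Longrightarrow> \<phi> v \<notin> F v"
    "\<And>v z. v \<in> D \<Longrightarrow> z \<in> Z \<Longrightarrow> adj v z \<Longrightarrow> \<phi> v \<noteq> c z"
    "\<And>u v. u \<in> D \<Longrightarrow> v \<in> D \<Longrightarrow> adj u v \<Longrightarrow> \<phi> u \<noteq> \<phi> v"
  shows "extension N D Z c F \<phi>"
  using assms by (simp add: extension_def)

lemma extensionD:
  assumes "extension N D Z c F \<phi>"
  shows "v \<in> D \<Longrightarrow> \<phi> v < N" "v \<in> D \<Longrightarrow> \<phi> v \<notin> F v"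
    "v \<in> D \<Longrightarrow> z \<in> Z \<Longrightarrow> adj v z \<Longrightarrow> \<phi> v \<noteq> c z"
    "u \<in> D \<Longrightarrow> v \<in> D \<Longrightarrow> adj u v \<Longrightarrow> \<phi> u \<noteq> \<phi> v"
  using assms by (simp_all add: extension_def)

text \<open>Cyclic shifts of the unused colours give many ways to colour \<open>D\<close> from a fixed
  \<open>M\<close>-colouring; on average at most \<open>q\<close> vertices receive a forbidden colour, and these are recoloured
  with distinct colours.\<close>

lemma list_extension_base:
  fixes c :: "'a \<Rightarrow> nat" and F :: "'a \<Rightarrow> nat set"
  assumes "q \<ge> 1" "finite D" "finite Z" "colourable D M"
    and F: "\<And>v. v \<in> D \<Longrightarrow> finite (F v)" "\<And>v. v \<in> D \<Longrightarrow> card (F v) \<le> q"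
    and weight: "q * card Z + (\<Sum>v\<in>D. card (F v)) \<le> 2 * q * q"
  shows "\<exists>\<phi>. extension (M + 4 * q) D Z c F \<phi>"
proof -
  define P where "P = {..<M + 4 * q} - c ` Z"
  define p where "p = card P"
  have "card Z * q \<le> (2 * q) * q"
    using weight by (subst mult.commute) linarith
  then have cZ: "card Z \<le> 2 * q" using assms(1) by simp
  have "card (c ` Z) \<le> 2 * q"
    using card_image_le[OF \<open>finite Z\<close>, of c] cZ by simp
  then have p: "M + 2 * q \<le> p"
    unfolding p_def P_def using diff_card_le_card_Diff[of "c ` Z" "{..<M + 4 * q}"] \<open>finite Z\<close> by simp
  have "p > 0" using p assms(1) by simp
  obtain e where e: "bij_betw e {0..<p} P"
    unfolding p_def using ex_bij_betw_nat_finite[of P] by (auto simp: P_def)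
  obtain g where g: "\<And>v. v \<in> D \<Longrightarrow> g v < M" "\<And>u v. u \<in> D \<Longrightarrow> v \<in> D \<Longrightarrow> adj u v \<Longrightarrow> g u \<noteq> g v"
    using assms(4) unfolding colourable_def by blast
  \<comment> \<open>The class \<open>g v\<close> is read as a position in the cyclically shifted
    palette \<open>P\<close> of colours that \<open>c\<close> leaves free. Since
    \<open>p >= M\<close>, distinct classes stay distinct, so each shift is proper on
    \<open>D\<close> and compatible with \<open>Z\<close>; only the sets \<open>F v\<close> can be
    violated.\<close>
  define f where "f t v = e ((g v + t) mod p)" for t v
  define X where "X t = {v\<in>D. f t v \<in> F v}" for t
  have finX: "finite (X t)" for t using assms(2) by (simp add: X_def)
  have inP: "f t v \<in> P" for t v
    using e \<open>p > 0\<close> by (auto simp: f_def bij_betw_def)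
  \<comment> \<open>A forbidden colour at \<open>v\<close> is hit by at most one shift. Counting
    pairs of a shift and a violated vertex gives at most \<open>2 * q * q\<close> of them over
    \<open>p >= 2 * q\<close> shifts, so some shift violates at most \<open>q\<close>
    vertices.\<close>
  have shift: "card {t. t < p \<and> f t v \<in> F v} \<le> card (F v)" if "v \<in> D" for v
  proof (rule card_inj_on_le)
    have "t = t'" if "t < p" "t' < p" "f t v = f t' v" for t t'
    proof -
      have "(g v + t) mod p = (g v + t') mod p"
        using that(3) e \<open>p > 0\<close> unfolding f_def bij_betw_def inj_on_def by auto
      then have "[g v + t = g v + t'] (mod p)" by (simp add: unique_euclidean_semiring_class.cong_def)
      then have "[t = t'] (mod p)" using cong_add_lcancel_nat by blast
      then show ?thesis using that(1,2) by (simp add: unique_euclidean_semiring_class.cong_def)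
    qed
    then show "inj_on (\<lambda>t. f t v) {t. t < p \<and> f t v \<in> F v}" by (auto simp: inj_on_def)
    show "(\<lambda>t. f t v) ` {t. t < p \<and> f t v \<in> F v} \<subseteq> F v" by auto
  qed (use F that in auto)
  have "(\<Sum>t<p. card (X t)) = (\<Sum>t<p. \<Sum>v\<in>D. if f t v \<in> F v then 1 else 0)"
    using assms(2) by (simp add: X_def sum.If_cases Int_def)
  also have "\<dots> = (\<Sum>v\<in>D. \<Sum>t<p. if f t v \<in> F v then 1 else 0)"
    by (rule sum.swap)
  also have "\<dots> = (\<Sum>v\<in>D. card {t. t < p \<and> f t v \<in> F v})"
    by (simp add: sum.If_cases Int_def)
  also have "\<dots> \<le> (\<Sum>v\<in>D. card (F v))"
    using shift by (rule sum_mono)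
  finally have total: "(\<Sum>t<p. card (X t)) \<le> 2 * q * q" using weight by linarith
  have "\<exists>t<p. card (X t) \<le> q"
  proof (rule ccontr)
    assume "\<not> ?thesis"
    then have "(\<Sum>t<p. Suc q) \<le> (\<Sum>t<p. card (X t))"
      by (intro sum_mono) (auto simp: not_le Suc_le_eq)
    then have "p * Suc q \<le> 2 * q * q" using total by simp
    moreover have "2 * q * Suc q \<le> p * Suc q" using p by (intro mult_le_mono1) simp
    ultimately show False using assms(1) by simp
  qed
  then obtain t where t: "card (X t) \<le> q" by blast
  have "f t ` D \<subseteq> (\<lambda>i. e ((i + t) mod p)) ` {..<M}"
    using g(1) by (auto simp: f_def)
  then have "card (f t ` D) \<le> card ((\<lambda>i. e ((i + t) mod p)) ` {..<M})"
    by (intro card_mono) auto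
  also have "\<dots> \<le> M"
    using card_image_le[of "{..<M}" "\<lambda>i. e ((i + t) mod p)"] by simp
  finally have cf: "card (f t ` D) \<le> M" .
  \<comment> \<open>Source of the \<open>4 * q\<close>: recolouring must avoid at most
    \<open>q\<close> forbidden colours, \<open>2 * q\<close> colours on \<open>Z\<close> and
    \<open>M\<close> colours used by the shift, and \<open>q\<close> more are needed to keep the new
    colours distinct.\<close>
  define B where "B v = F v \<union> c ` Z \<union> f t ` D" for v
  have "card (B v) + card (X t) \<le> M + 4 * q" if "v \<in> X t" for v
  proof -
    have "card (B v) \<le> card (F v) + card (c ` Z) + card (f t ` D)"
      using card_Un_le[of "F v \<union> c ` Z" "f t ` D"] card_Un_le[of "F v" "c ` Z"]
      unfolding B_def by linarith
    then show ?thesis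
      using F(2)[of v] that t cf \<open>card (c ` Z) \<le> 2 * q\<close> by (auto simp: X_def)
  qed
  then obtain \<psi> where \<psi>: "inj_on \<psi> (X t)" "\<forall>v\<in>X t. \<psi> v < M + 4 * q \<and> \<psi> v \<notin> B v"
    using distinct_list_colouring[OF finX, of t B "M + 4 * q"] F(1) assms(2,3)
    by (auto simp: B_def X_def)
  define \<phi> where "\<phi> v = (if v \<in> X t then \<psi> v else f t v)" for v
  have "\<phi> v < M + 4 * q \<and> \<phi> v \<notin> F v \<and> \<phi> v \<notin> c ` Z" if "v \<in> D" for v
    using \<psi>(2) inP[of t v] that by (auto simp: \<phi>_def B_def P_def X_def)
  moreover have "\<phi> u \<noteq> \<phi> v" if uv: "u \<in> D" "v \<in> D" "adj u v" for u v
  proof -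
    have "f t u \<noteq> f t v"
    proof
      assume "f t u = f t v"
      then have "(g u + t) mod p = (g v + t) mod p"
        using e \<open>p > 0\<close> unfolding f_def bij_betw_def inj_on_def by auto
      then have "[g u + t = g v + t] (mod p)" by (simp add: unique_euclidean_semiring_class.cong_def)
      then have "[g u = g v] (mod p)" using cong_add_rcancel_nat by blast
      then have "g u = g v"
        using g(1)[OF uv(1)] g(1)[OF uv(2)] p by (simp add: unique_euclidean_semiring_class.cong_def)
      then show False using g(2) uv by blast
    qed
    moreover have "u \<noteq> v" using uv(3) adj_irrefl by auto
    moreover have "f t u \<in> B v" "f t v \<in> B u"
      using uv by (auto simp: B_def)
    ultimately show ?thesis
      using \<psi>(2) inj_onD[OF \<psi>(1), of u v] unfolding \<phi>_def by (metis (full_types))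
  qed
  ultimately show ?thesis by (intro exI[of _ \<phi>] extensionI) auto
qed

text \<open>A precoloured vertex has weight \<open>q\<close> and a forbidden colour at a vertex has weight \<open>1\<close>. When a
  separator of size \<open>q\<close> splits the graph, one side carries at most half of the total weight
  \<open>2 * q * q\<close>, which leaves room for precolouring the separator on that side.\<close>

lemma list_extension:
  fixes c :: "'a \<Rightarrow> nat" and F :: "'a \<Rightarrow> nat set"
  assumes "q \<ge> 1" "finite V"
    and linked: "\<And>U. U \<subseteq> V \<Longrightarrow> linked q U \<Longrightarrow> colourable U M"
    and "D \<subseteq> V" "Z \<subseteq> V" "D \<inter> Z = {}"
    and "\<And>v. v \<in> D \<Longrightarrow> finite (F v)" "\<And>v. v \<in> D \<Longrightarrow> card (F v) \<le> q"
    and "q * card Z + (\<Sum>v\<in>D. card (F v)) \<le> 2 * q * q"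
  shows "\<exists>\<phi>. extension (M + 4 * q) D Z c F \<phi>"
  using assms(4-)
\<comment> \<open>The weight bound forces \<open>card Z <= 2 * q\<close>, so the factor
  \<open>2 * q + 1\<close> makes the measure lexicographic: losing one vertex of \<open>D\<close>
  outweighs any growth of \<open>Z\<close>.\<close>
proof (induction "card D * (2 * q + 1) + card Z" arbitrary: D Z c F rule: less_induct)
  case less
  note D = less.prems(1) and Z = less.prems(2) and DZ = less.prems(3)
    and F = less.prems(4,5) and weight = less.prems(6)
  have fin: "finite D" "finite Z" using D Z assms(2) finite_subset by auto
  have "card Z * q \<le> (2 * q) * q"
    using weight by (subst mult.commute) linarith
  then have cZ: "card Z \<le> 2 * q" using assms(1) by simp
  \<comment> \<open>A vertex with \<open>q\<close> forbidden colours is coloured and moved to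
    \<open>Z\<close> at equal weight. A vertex of \<open>Z\<close> with at most \<open>q\<close>
    neighbours in \<open>D\<close> is traded for one forbidden colour at each of them; no set
    \<open>F v\<close> is full then, so all stay within \<open>q\<close>. Only the heavy case needs
    a separator.\<close>
  consider (full) v where "v \<in> D" "card (F v) = q"
    | (light) z where "z \<in> Z" "card (nbr z \<inter> D) \<le> q" "\<And>v. v \<in> D \<Longrightarrow> card (F v) < q"
    | (heavy) "\<And>z. z \<in> Z \<Longrightarrow> q < card (nbr z \<inter> D)"
    using F(2) by (metis le_neq_implies_less not_le)
  then show ?case
  proof cases
    case full
    have "card (F v \<union> c ` Z) \<le> q + card Z"
      using card_Un_le[of "F v" "c ` Z"] card_image_le[OF fin(2), of c] full(2) by linarith
    also have "\<dots> < M + 4 * q" using cZ assms(1) by simp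
    finally have "\<not> {..<M + 4 * q} \<subseteq> F v \<union> c ` Z"
      using F(1)[OF full(1)] fin(2)
      by (metis card_lessThan card_mono finite_UnI finite_imageI linorder_not_less)
    then obtain a where a: "a < M + 4 * q" "a \<notin> F v" "a \<notin> c ` Z" by auto
    have vZ: "v \<notin> Z" using full(1) DZ by auto
    have cD: "card D = Suc (card (D - {v}))" using full(1) fin(1) by (metis card.remove)
    have "(\<Sum>v\<in>D. card (F v)) = q + (\<Sum>v\<in>D - {v}. card (F v))"
      using full fin(1) by (simp add: sum.remove)
    then have w: "q * card (insert v Z) + (\<Sum>v\<in>D - {v}. card (F v)) \<le> 2 * q * q"
      using weight vZ fin(2) by (simp add: algebra_simps)
    have m: "card (D - {v}) * (2 * q + 1) + card (insert v Z) < card D * (2 * q + 1) + card Z"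
      using cD vZ fin(2) assms(1) by simp
    have "\<exists>\<phi>. extension (M + 4 * q) (D - {v}) (insert v Z) (c(v := a)) F \<phi>"
    proof (rule less.hyps[OF m _ _ _ _ _ w])
      show "insert v Z \<subseteq> V" using D Z full(1) by blast
    qed (use D DZ F in auto)
    then obtain \<phi> where \<phi>: "extension (M + 4 * q) (D - {v}) (insert v Z) (c(v := a)) F \<phi>" ..
    have "extension (M + 4 * q) D Z c F (\<phi>(v := a))"
    proof (rule extensionI)
      fix u assume "u \<in> D"
      then show "(\<phi>(v := a)) u < M + 4 * q" "(\<phi>(v := a)) u \<notin> F u"
        using extensionD(1,2)[OF \<phi>, of u] a by (cases "u = v"; simp)+
    next
      fix u z assume "u \<in> D" "z \<in> Z" "adj u z"
      then show "(\<phi>(v := a)) u \<noteq> c z"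
        using extensionD(3)[OF \<phi>, of u z] a(3) vZ by (cases "u = v"; cases "z = v"; auto)
    next
      fix u w assume "u \<in> D" "w \<in> D" "adj u w"
      then show "(\<phi>(v := a)) u \<noteq> (\<phi>(v := a)) w"
        using extensionD(4)[OF \<phi>, of u w] extensionD(3)[OF \<phi>, of u v] extensionD(3)[OF \<phi>, of w v]
          adj_irrefl adj_sym[of u w]
        by (cases "u = v"; cases "w = v"; auto)
    qed
    then show ?thesis by blast
  next
    case light
    define F' where "F' v = (if adj z v then insert (c z) (F v) else F v)" for v
    have F': "finite (F' v)" "card (F' v) \<le> q" if "v \<in> D" for v
      using F(1)[OF that] light(3)[OF that] card_insert_le_m1[of q "F v" "c z"]
      by (auto simp: F'_def)
    have "(\<Sum>v\<in>D. card (F' v)) \<le> (\<Sum>v\<in>D. card (F v) + (if adj z v then 1 else 0))"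
      using F(1) by (intro sum_mono) (auto simp: F'_def card_insert_if)
    also have "\<dots> = (\<Sum>v\<in>D. card (F v)) + card (nbr z \<inter> D)"
      using fin(1) by (simp add: sum.distrib sum.If_cases nbr_def Int_commute)
    finally have "(\<Sum>v\<in>D. card (F' v)) \<le> (\<Sum>v\<in>D. card (F v)) + q"
      using light(2) by linarith
    moreover have cZ': "card Z = Suc (card (Z - {z}))"
      using light(1) fin(2) by (metis card.remove)
    ultimately have w: "q * card (Z - {z}) + (\<Sum>v\<in>D. card (F' v)) \<le> 2 * q * q"
      using weight by simp
    have m: "card D * (2 * q + 1) + card (Z - {z}) < card D * (2 * q + 1) + card Z"
      using cZ' by simp
    have "\<exists>\<phi>. extension (M + 4 * q) D (Z - {z}) c F' \<phi>"
      by (rule less.hyps[OF m D _ _ _ _ w]) (use Z DZ F' in auto)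
    then obtain \<phi> where \<phi>: "extension (M + 4 * q) D (Z - {z}) c F' \<phi>" ..
    have "extension (M + 4 * q) D Z c F \<phi>"
    proof (rule extensionI)
      fix u assume "u \<in> D"
      then show "\<phi> u < M + 4 * q" "\<phi> u \<notin> F u"
        using extensionD(1,2)[OF \<phi>, of u] by (auto simp: F'_def split: if_splits)
    next
      fix u y assume "u \<in> D" "y \<in> Z" "adj u y"
      then show "\<phi> u \<noteq> c y"
        using extensionD(2)[OF \<phi>, of u] extensionD(3)[OF \<phi>, of u y] adj_sym[of u y]
        by (cases "y = z") (auto simp: F'_def)
    qed (use extensionD(4)[OF \<phi>] in blast)
    then show ?thesis by blast
  next
    case heavy
    show ?thesis
    proof (cases "linked q (D \<union> Z)")
      case True
      then have "colourable D M"
        using linked[of "D \<union> Z"] D Z colourable_mono[of "D \<union> Z" M D M] by auto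
      then show ?thesis
        by (rule list_extension_base[OF assms(1) fin _ F weight])
    next
      case False
      then obtain S0 where S0: "finite S0" "card S0 \<le> q" "\<not> conn (D \<union> Z - S0)"
        unfolding linked_def by blast
      define S where "S = S0 \<inter> (D \<union> Z)"
      have S: "S \<subseteq> D \<union> Z" "finite S" "card S \<le> q" "\<not> conn (D \<union> Z - S)"
        using S0 card_mono[of S0 S] by (auto simp: S_def Diff_Int)
      then obtain A where A: "A \<subseteq> D \<union> Z - S" "A \<noteq> {}" "A \<noteq> D \<union> Z - S"
        "\<And>a b. a \<in> A \<Longrightarrow> b \<in> D \<union> Z - S - A \<Longrightarrow> \<not> adj a b"
        unfolding conn_def by blast
      \<comment> \<open>The share of the total weight carried by \<open>X\<close>. The two sides of
        the cut are disjoint, so one of them carries at most \<open>q * q\<close>; it is called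
        \<open>B\<close> below.\<close>
      define w where "w X = q * card (X \<inter> Z) + (\<Sum>v\<in>X \<inter> D. card (F v))" for X
      define A' where "A' = D \<union> Z - S - A"
      have A': "A' \<subseteq> D \<union> Z - S" "A' \<noteq> {}" "A \<inter> A' = {}" "A \<union> A' = D \<union> Z - S"
        using A by (auto simp: A'_def)
      have non: "\<not> adj b a" if "b \<in> A'" "a \<in> A" for a b
        using A(4)[of a b] that adj_commute unfolding A'_def by blast
      have non': "\<not> adj a b" if "a \<in> A" "b \<in> A'" for a b
        using non[OF that(2,1)] adj_sym by blast
      have finA: "finite A" "finite A'" using A A' fin by (meson finite_Diff finite_UnI finite_subset)+
      have "w A + w A' = w (A \<union> A')"
      proof -
        have "card ((A \<union> A') \<inter> Z) = card (A \<inter> Z) + card (A' \<inter> Z)"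
          unfolding Int_Un_distrib2 using A'(3) finA by (intro card_Un_disjoint) auto
        moreover have "(\<Sum>v\<in>(A \<union> A') \<inter> D. card (F v)) = (\<Sum>v\<in>A \<inter> D. card (F v)) + (\<Sum>v\<in>A' \<inter> D. card (F v))"
          unfolding Int_Un_distrib2 using A'(3) finA by (intro sum.union_disjoint) auto
        ultimately show ?thesis by (simp add: w_def add_mult_distrib2)
      qed
      also have "\<dots> \<le> w (D \<union> Z)"
        unfolding w_def A'(4) using fin
        by (intro add_mono mult_le_mono2 card_mono sum_mono2) auto
      also have "\<dots> \<le> 2 * q * q"
        unfolding w_def using weight DZ by (simp add: Int_Un_distrib2 Int_commute Int_absorb)
      finally have "w A \<le> q * q \<or> w A' \<le> q * q" by linarith
      then obtain B C where BC: "B \<noteq> {}" "C \<noteq> {}" "B \<inter> C = {}" "B \<union> C = D \<union> Z - S" "w B \<le> q * q"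
        "\<And>b a. b \<in> B \<Longrightarrow> a \<in> C \<Longrightarrow> \<not> adj b a"
      proof
        assume "w A \<le> q * q"
        then show thesis
          by (intro that[of A A']) (use A(2) A' non' in auto)
      next
        assume "w A' \<le> q * q"
        then show thesis
          by (intro that[of A' A]) (use A(2) A' non in auto)
      qed
      \<comment> \<open>Both sides contain uncoloured vertices: a vertex of \<open>Z\<close> on a
        side without them would have all its neighbours in \<open>D\<close> inside \<open>S\<close>,
        hence at most \<open>q\<close>. This makes both recursive calls smaller.\<close>
      have meets: "X \<inter> D \<noteq> {}" if X: "X \<noteq> {}" "X \<subseteq> D \<union> Z - S" "\<And>b a. b \<in> X \<Longrightarrow> a \<in> D \<union> Z - S - X \<Longrightarrow> \<not> adj b a" for X
      proof
        assume XD: "X \<inter> D = {}"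
        obtain b where b: "b \<in> X" using X(1) by blast
        then have "b \<in> Z" using X(2) XD by blast
        have "nbr b \<inter> D \<subseteq> S"
          using X(3)[OF b] XD by fastforce
        then have "card (nbr b \<inter> D) \<le> q"
          using S(2,3) card_mono le_trans by blast
        then show False using heavy[OF \<open>b \<in> Z\<close>] by simp
      qed
      have BD: "B \<inter> D \<noteq> {}" using meets[of B] BC by blast
      have CD: "C \<inter> D \<noteq> {}" using meets[of C] BC adj_sym by blast
      have BCsub: "B \<subseteq> D \<union> Z - S" "C \<subseteq> D \<union> Z - S" using BC(4) by blast+
      have "D - B \<subset> D" using BD by blast
      then have "card (D - B) < card D" using fin(1) by (simp add: psubset_card_mono)
      then have m1: "card (D - B) * (2 * q + 1) + card Z < card D * (2 * q + 1) + card Z"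
        by (intro add_strict_right_mono mult_strict_right_mono) simp_all
      have w1: "q * card Z + (\<Sum>v\<in>D - B. card (F v)) \<le> 2 * q * q"
        using weight sum_mono2[of D "D - B" "\<lambda>v. card (F v)"] fin(1) by fastforce
      have "\<exists>\<phi>. extension (M + 4 * q) (D - B) Z c F \<phi>"
        by (rule less.hyps[OF m1 _ Z _ _ _ w1]) (use D DZ F in auto)
      then obtain \<phi> where \<phi>: "extension (M + 4 * q) (D - B) Z c F \<phi>" ..
      \<comment> \<open>Everything outside \<open>B\<close>, in particular the separator, is
        coloured by now. For \<open>B\<close> the separator counts as precoloured, which adds at
        most \<open>q * q\<close> to \<open>w B\<close>. Edges of \<open>D \<union> Z\<close> leave
        \<open>B\<close> only towards \<open>S\<close>, so the two colourings fit together.\<close>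
      define c' where "c' v = (if v \<in> Z then c v else \<phi> v)" for v
      define Z' where "Z' = (B \<inter> Z) \<union> S"
      have "card Z' \<le> card (B \<inter> Z) + q"
        using card_Un_le[of "B \<inter> Z" S] S(3) by (simp add: Z'_def)
      then have "q * card Z' \<le> q * card (B \<inter> Z) + q * q"
        by (metis add_mult_distrib2 mult_le_mono2)
      then have w2: "q * card Z' + (\<Sum>v\<in>B \<inter> D. card (F v)) \<le> 2 * q * q"
        using BC(5) by (simp add: w_def)
      have "card Z' * q \<le> (2 * q) * q" using w2 by (subst mult.commute) linarith
      then have "card Z' \<le> 2 * q" using assms(1) by simp
      moreover have "B \<inter> D \<subset> D" using CD BC(3) by blast
      then have "Suc (card (B \<inter> D)) \<le> card D" using fin(1) by (simp add: psubset_card_mono Suc_le_eq)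
      then have "Suc (card (B \<inter> D)) * (2 * q + 1) \<le> card D * (2 * q + 1)" by (rule mult_le_mono1)
      ultimately have m2: "card (B \<inter> D) * (2 * q + 1) + card Z' < card D * (2 * q + 1) + card Z" by simp
      have "\<exists>\<psi>. extension (M + 4 * q) (B \<inter> D) Z' c' F \<psi>"
      proof (rule less.hyps[OF m2 _ _ _ _ _ w2])
        show "Z' \<subseteq> V" using D Z S(1) by (auto simp: Z'_def)
        show "B \<inter> D \<inter> Z' = {}" using DZ BCsub(1) by (auto simp: Z'_def)
      qed (use D F in auto)
      then obtain \<psi> where \<psi>: "extension (M + 4 * q) (B \<inter> D) Z' c' F \<psi>" ..
      have BS: "x \<in> S \<or> x \<in> B" if "b \<in> B" "adj b x" "x \<in> D \<union> Z" for b x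
        using BC(4,6) that by blast
      have cross: "\<psi> u \<noteq> \<phi> v" if "u \<in> B \<inter> D" "v \<in> D - B" "adj u v" for u v
      proof -
        have "v \<in> S" "v \<notin> Z" using BS[of u v] that DZ by auto
        then show ?thesis
          using extensionD(3)[OF \<psi> that(1) _ that(3)] by (simp add: c'_def Z'_def)
      qed
      define \<chi> where "\<chi> v = (if v \<in> B then \<psi> v else \<phi> v)" for v
      have "extension (M + 4 * q) D Z c F \<chi>"
      proof (rule extensionI)
        fix v assume "v \<in> D"
        then show "\<chi> v < M + 4 * q" "\<chi> v \<notin> F v"
          using extensionD(1,2)[OF \<phi>, of v] extensionD(1,2)[OF \<psi>, of v] by (simp_all add: \<chi>_def)
      next
        fix v z assume vz: "v \<in> D" "z \<in> Z" "adj v z"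
        show "\<chi> v \<noteq> c z"
        proof (cases "v \<in> B")
          case True
          then have "z \<in> Z'" using BS[OF True vz(3)] vz by (auto simp: Z'_def)
          then show ?thesis
            using extensionD(3)[OF \<psi>, of v z] True vz by (simp add: \<chi>_def c'_def)
        next
          case False
          then show ?thesis using extensionD(3)[OF \<phi>, of v z] vz by (simp add: \<chi>_def)
        qed
      next
        fix u v assume uv: "u \<in> D" "v \<in> D" "adj u v"
        show "\<chi> u \<noteq> \<chi> v"
          using extensionD(4)[OF \<phi>, of u v] extensionD(4)[OF \<psi>, of u v] cross[of u v]
            cross[of v u] adj_sym[OF uv(3)] uv
          by (cases "u \<in> B"; cases "v \<in> B"; simp add: \<chi>_def; metis)
      qed
      then show ?thesis by blast
    qed
  qed
qed

text \<open>Contrapositive of \<open>list_extension\<close> with nothing precoloured and nothing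
  forbidden.\<close>

lemma highly_linked_subgraph:
  assumes "q \<ge> 1" "finite V" "\<not> colourable V (M + 4 * q)"
  obtains U where "U \<subseteq> V" "linked q U" "\<not> colourable U M"
proof (rule ccontr)
  assume "\<not> thesis"
  then have *: "\<And>U. U \<subseteq> V \<Longrightarrow> linked q U \<Longrightarrow> colourable U M"
    using that by blast
  have "colourable V (M + 4 * q)"
    using list_extension[OF assms(1,2) *, of V "{}" "\<lambda>_. {}"]
    unfolding colourable_def extension_def by auto
  then show False using assms(3) by simp
qed

subsection \<open>Growing an induced path\<close>


fun ipath :: "'a list \<Rightarrow> bool" where
  "ipath [] \<longleftrightarrow> True"
| "ipath [x] \<longleftrightarrow> True"
| "ipath (x # y # zs) \<longleftrightarrow> adj x y \<and> x \<notin> set zs \<and> (\<forall>z\<in>set zs. \<not> adj x z) \<and> ipath (y # zs)"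

lemma ipath_drop: "ipath xs \<Longrightarrow> ipath (drop n xs)"
proof (induction n arbitrary: xs)
  case (Suc n)
  then show ?case by (cases xs rule: ipath.cases) auto
qed simp

lemma ipath_distinct: "ipath xs \<Longrightarrow> distinct xs"
  by (induction xs rule: ipath.induct) (auto simp: adj_irrefl)

lemma ipath_nth_less:
  assumes "ipath xs" "i < j" "j < length xs"
  shows "adj (xs ! i) (xs ! j) \<longleftrightarrow> j = Suc i"
  using assms
proof (induction xs arbitrary: i j rule: ipath.induct)
  case (3 x y zs)
  obtain j' where j: "j = Suc j'" using 3(3) by (cases j) auto
  show ?case
  proof (cases i)
    case 0
    show ?thesis
    proof (cases j')
      case (Suc l)
      then have "zs ! l \<in> set zs" using 3(4) j by simp
      then show ?thesis using 3(2) 0 j Suc by auto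
    qed (use 3(2) 0 j in auto)
  next
    case (Suc i')
    then show ?thesis using 3(1)[of i' j'] 3(2-4) j by auto
  qed
qed auto

lemma ipath_nth:
  assumes "ipath xs" "i < length xs" "j < length xs"
  shows "adj (xs ! i) (xs ! j) \<longleftrightarrow> j = Suc i \<or> i = Suc j"
  using ipath_nth_less[OF assms(1), of i j] ipath_nth_less[OF assms(1), of j i] assms adj_irrefl adj_commute
  by (cases i j rule: linorder_cases) auto

text \<open>Jumping from \<open>x\<close> to its last neighbour on the walk and repeating from there
  leaves an induced path. The rest \<open>ps\<close> of the old path has no neighbours on the walk,
  so the new piece can be put in front of it.\<close>

lemma shorten_walk:
  assumes "successively adj (x # ws)" "ws \<noteq> []" "ipath (x # ps)"
    and "set ws \<inter> set (x # ps) = {}" "\<And>v w. v \<in> set ps \<Longrightarrow> w \<in> set ws \<Longrightarrow> \<not> adj v w"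
  shows "\<exists>qs. ipath (last ws # qs @ x # ps) \<and> set qs \<subseteq> set (butlast ws) \<and> last ws \<notin> set qs"
  using assms
proof (induction "length ws" arbitrary: x ws ps rule: less_induct)
  case less
  have "\<exists>u\<in>set ws. adj x u" using less.prems(1,2) by (cases ws) auto
  then obtain ws1 u ws2 where ws: "ws = ws1 @ u # ws2" "adj x u" "\<forall>w\<in>set ws2. \<not> adj x w"
    using split_list_last_prop[of ws "adj x"] by blast
  have ip: "ipath (u # x # ps)"
    using less.prems(3-5) ws adj_commute by auto
  show ?case
  proof (cases "ws2 = []")
    case True
    then show ?thesis using ip ws by (intro exI[of _ "[]"]) auto
  next
    case False
    have "u \<notin> set ws2" using ws by blast
    have "\<exists>qs. ipath (last ws2 # qs @ u # x # ps) \<and> set qs \<subseteq> set (butlast ws2) \<and> last ws2 \<notin> set qs"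
    proof (rule less.hyps)
      show "successively adj (u # ws2)"
        using less.prems(1) ws(1) by (auto simp: successively_append_iff successively_Cons)
      show "set ws2 \<inter> set (u # x # ps) = {}"
        using \<open>u \<notin> set ws2\<close> less.prems(4) ws(1) by auto
    qed (use False ip ws less.prems(5) in auto)
    then obtain qs where qs: "ipath (last ws2 # qs @ u # x # ps)" "set qs \<subseteq> set (butlast ws2)" "last ws2 \<notin> set qs"
      by blast
    have "u \<noteq> last ws2" using \<open>u \<notin> set ws2\<close> False by (metis last_in_set)
    then show ?thesis
      using qs ws(1) False by (intro exI[of _ "qs @ [u]"]) (auto simp: butlast_append)
  qed
qed

text \<open>The path is stored with its current end \<open>x\<close> first; \<open>A\<close> is the set in which it continues.\<close>

definition attached :: "nat \<Rightarrow> 'a list \<Rightarrow> 'a \<Rightarrow> 'a set \<Rightarrow> bool" where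
  "attached r ps x A \<longleftrightarrow> ipath (x # ps) \<and> set (x # ps) \<inter> A = {} \<and>
     (\<forall>v\<in>set ps. \<forall>a\<in>A. \<not> adj v a) \<and> linked (r - 1) A \<and> r \<le> card (nbr x \<inter> A)"

text \<open>The common neighbourhood of \<open>Y\<close> and the sets of non-neighbours of its
  members cover \<open>U\<close>; if all of the latter were \<open>b\<close>-colourable, disjoint
  palettes would colour \<open>U\<close> too cheaply.\<close>

lemma stable_split:
  assumes "finite Y" "\<not> colourable U (d + card Y * b)" "colourable {v\<in>U. \<forall>y\<in>Y. adj y v} d"
  obtains y where "y \<in> Y" "\<not> colourable (U - nbr y) b"
proof -
  have "\<exists>y\<in>Y. \<not> colourable (U - nbr y) b"
  proof (rule ccontr)
    assume "\<not> ?thesis"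
    then have "colourable (\<Union>y\<in>Y. U - nbr y) (card Y * b)"
      using assms(1) by (intro colourable_UN) auto
    then have "colourable ({v\<in>U. \<forall>y\<in>Y. adj y v} \<union> (\<Union>y\<in>Y. U - nbr y)) (d + card Y * b)"
      using assms(3) by (intro colourable_Un)
    moreover have "U \<subseteq> {v\<in>U. \<forall>y\<in>Y. adj y v} \<union> (\<Union>y\<in>Y. U - nbr y)" by auto
    ultimately show False using assms(2) colourable_mono by blast
  qed
  then show ?thesis using that by blast
qed

text \<open>Only interior vertices of the walk are kept in \<open>A\<close> and away from
  \<open>B\<close>. The endpoint is exempt, since it is to become the path vertex with neighbours in
  \<open>B\<close>.\<close>

definition reachable :: "'a \<Rightarrow> 'a set \<Rightarrow> 'a set \<Rightarrow> 'a \<Rightarrow> bool" where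
  "reachable x A B y \<longleftrightarrow> (\<exists>ws. successively adj (x # ws @ [y]) \<and> set ws \<subseteq> A \<and>
     (\<forall>w\<in>set ws. \<forall>b\<in>B. \<not> adj w b))"

text \<open>The candidates \<open>y\<close> for the next end of the path: after the few vertices of \<open>T\<close> are dropped
  from \<open>U\<close>, the way from \<open>x\<close> to \<open>y\<close> is anticomplete to \<open>U\<close>, while \<open>y\<close> itself still has at least
  \<open>r\<close> neighbours in \<open>U\<close>.\<close>

definition extendable :: "nat \<Rightarrow> 'a \<Rightarrow> 'a set \<Rightarrow> 'a set \<Rightarrow> 'a \<Rightarrow> bool" where
  "extendable r x A U y \<longleftrightarrow> (\<exists>T\<subseteq>U. card T \<le> 2 * r - 2 \<and> y \<in> A \<and> y \<notin> U - T \<and>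
     reachable x (A - U) (U - T) y \<and> r \<le> card (nbr y \<inter> (U - T)))"

text \<open>If the set \<open>S\<close> of candidates had fewer than \<open>r\<close> members,
  \<open>A - S\<close> would be connected, and a search from \<open>x\<close> through vertices
  anticomplete to \<open>U - S\<close> would reach some \<open>w\<close> outside \<open>U\<close>
  with a neighbour in \<open>U - S\<close>. Either \<open>w\<close> is a candidate or such a
  neighbour is, and neither lies in \<open>S\<close>.\<close>

lemma many_extendable:
  assumes "r \<ge> 2" "finite A" "linked (r - 1) A" "r \<le> card (nbr x \<inter> A)"
    and "U \<subseteq> A - nbr x" "linked (3 * r - 3) U" "3 * r - 2 < card U"
  shows "r \<le> card {y. extendable r x A U y}"
proof (rule ccontr)
  define S where "S = {y. extendable r x A U y}"
  assume "\<not> ?thesis"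
  then have cS: "card S \<le> r - 1" by (simp add: S_def)
  have SA: "S \<subseteq> A" by (auto simp: S_def extendable_def)
  then have finS: "finite S" using assms(2) finite_subset by blast
  have finU: "finite U" using assms(2,5) finite_subset by auto
  define T where "T = S \<inter> U"
  have T: "T \<subseteq> U" "card T \<le> r - 1"
    using cS card_mono[OF finS, of T] by (auto simp: T_def)
  \<comment> \<open>The vertices found by the search that may serve as interior vertices of a walk.
    Some edge must lead from \<open>x\<close> or from \<open>R\<close> to a vertex \<open>w\<close>
    outside \<open>R\<close>.\<close>
  define R where "R = {v\<in>A - U. (\<forall>b\<in>U - T. \<not> adj v b) \<and> reachable x (A - U) (U - T) v}"
  have step: "reachable x (A - U) B w" if "v = x \<or> v \<in> A - U \<and> (\<forall>b\<in>B. \<not> adj v b) \<and> reachable x (A - U) B v" "adj v w" for v w B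
    using that(1)
  proof
    assume "v = x"
    then show ?thesis using that(2) by (auto simp: reachable_def intro!: exI[of _ "[]"])
  next
    assume *: "v \<in> A - U \<and> (\<forall>b\<in>B. \<not> adj v b) \<and> reachable x (A - U) B v"
    then obtain ws where ws: "successively adj (x # ws @ [v])" "set ws \<subseteq> A - U" "\<forall>w\<in>set ws. \<forall>b\<in>B. \<not> adj w b"
      unfolding reachable_def by blast
    have "successively adj ((x # ws @ [v]) @ [w])"
      using ws(1) that(2) unfolding successively_append_iff by simp
    then show ?thesis
      using * ws unfolding reachable_def by (intro exI[of _ "ws @ [v]"]) auto
  qed
  have con: "conn (A - S)" using assms(3) finS cS unfolding linked_def by blast
  have "\<exists>u. u \<in> nbr x \<inter> A - S"
  proof (rule ccontr)
    assume "\<not> ?thesis"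
    then have "card (nbr x \<inter> A) \<le> card S" using finS by (intro card_mono) auto
    then show False using assms(1,4) cS by linarith
  qed
  then obtain u where u: "adj x u" "u \<in> A - S" by auto
  have "\<exists>z. z \<in> U - S"
  proof (rule ccontr)
    assume "\<not> ?thesis"
    then have "card U \<le> card S" using finS by (intro card_mono) auto
    then show False using assms(1,7) cS by linarith
  qed
  then obtain z where z: "z \<in> U - S" by auto
  have "\<exists>v w. (v = x \<or> v \<in> R) \<and> w \<in> A - S - R \<and> adj v w"
  proof (cases "u \<in> R")
    case False
    then show ?thesis using u by blast
  next
    case True
    have "z \<in> A - S" "z \<notin> R \<inter> (A - S)" using z assms(5) by (auto simp: R_def)
    moreover have "u \<in> R \<inter> (A - S)" using u True by blast
    ultimately obtain v w where "v \<in> R \<inter> (A - S)" "w \<in> A - S" "w \<notin> R \<inter> (A - S)" "adj v w"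
      using connD[OF con, of "R \<inter> (A - S)" u z] by blast
    then show ?thesis by blast
  qed
  then obtain v w where vw: "v = x \<or> v \<in> R" "w \<in> A - S - R" "adj v w" by blast
  have rw: "reachable x (A - U) (U - T) w"
    using vw(1,3) step[of v "U - T" w] by (auto simp: R_def)
  \<comment> \<open>The search cannot enter \<open>U\<close> directly: \<open>U\<close> avoids the
    neighbours of \<open>x\<close>, and \<open>R\<close> has no neighbours in
    \<open>U - T\<close>.\<close>
  have wU: "w \<notin> U"
  proof
    assume "w \<in> U"
    then have "w \<in> U - T" using vw(2) by (auto simp: T_def)
    then show False using vw assms(5) by (auto simp: R_def)
  qed
  then obtain y where y: "y \<in> U - T" "adj w y"
    using vw(2) rw by (auto simp: R_def)
  show False
  proof (cases "r \<le> card (nbr w \<inter> (U - T))")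
    case True
    then have "extendable r x A U w"
      using T vw(2) rw wU assms(1) unfolding extendable_def by (intro exI[of _ T]) auto
    then show False using vw(2) by (simp add: S_def)
  next
    case False
    \<comment> \<open>Dropping also the fewer than \<open>r\<close> neighbours of \<open>w\<close>
      turns \<open>w\<close> into an admissible interior vertex. As \<open>y\<close> has at least
      \<open>3 * r - 2\<close> neighbours in \<open>U\<close> and at most \<open>2 * r - 2\<close>
      vertices are dropped, it keeps \<open>r\<close> of them; this fixes the choice
      \<open>3 * r - 3\<close>.\<close>
    define T' where "T' = T \<union> (nbr w \<inter> (U - T))"
    have T': "T' \<subseteq> U" "card T' \<le> 2 * r - 2"
      using T False card_Un_le[of T "nbr w \<inter> (U - T)"] by (auto simp: T'_def)
    have "T \<subseteq> T'" by (simp add: T'_def)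
    have "reachable x (A - U) (U - T') w"
      using rw \<open>T \<subseteq> T'\<close> unfolding reachable_def by blast
    then have ry: "reachable x (A - U) (U - T') y"
      using vw(2) wU y(2) by (intro step[of w]) (auto simp: T'_def)
    have "3 * r - 3 < card (nbr y \<inter> U)"
      using linked_degree[OF assms(6) finU, of y] y(1) assms(1,7) by simp
    moreover have "card (nbr y \<inter> U) \<le> card (nbr y \<inter> (U - T')) + card T'"
    proof -
      have "card (nbr y \<inter> U) \<le> card (nbr y \<inter> (U - T') \<union> T')"
        using finU T'(1) by (intro card_mono) (auto intro: finite_subset)
      also have "\<dots> \<le> card (nbr y \<inter> (U - T')) + card T'" by (rule card_Un_le)
      finally show ?thesis .
    qed
    ultimately have "r \<le> card (nbr y \<inter> (U - T'))" using T'(2) by linarith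
    moreover have "y \<in> T'" using y by (simp add: T'_def)
    moreover have "y \<in> A" using y(1) assms(5) by blast
    ultimately have "extendable r x A U y"
      using T' ry unfolding extendable_def by blast
    then show False using y(1) by (simp add: S_def T_def)
  qed
qed

text \<open>One round of path growing. The colours \<open>4 * (3 * r - 3)\<close> buy a linked
  \<open>U\<close> among the non-neighbours of \<open>x\<close>; among the candidates there is a
  stable \<open>s\<close>-set, and \<open>stable_split\<close> picks the new end from it at the cost
  of \<open>d\<close> and the factor \<open>s\<close>; \<open>2 * r - 2\<close> pays for the dropped
  set \<open>T\<close>.\<close>

lemma extend_path:
  assumes "r \<ge> 2" "finite A" "attached r ps x A"
    and ramsey: "\<And>X. X \<subseteq> A \<Longrightarrow> r \<le> card X \<Longrightarrow> \<exists>Y\<subseteq>X. card Y = s \<and> stable Y"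
    and common: "\<And>Y. Y \<subseteq> A \<Longrightarrow> card Y = s \<Longrightarrow> stable Y \<Longrightarrow> colourable {v\<in>A. \<forall>y\<in>Y. adj y v} d"
    and "s \<ge> 2" "d + 1 \<ge> r"
    and "\<not> colourable (A - nbr x) (d + s * (b + (2 * r - 2)) + 4 * (3 * r - 3))"
  shows "\<exists>y qs A'. attached r (qs @ x # ps) y A' \<and> A' \<subseteq> A \<and> y \<in> A \<and> set qs \<subseteq> A \<and>
    \<not> colourable (A' - nbr y) b"
proof -
  note att = assms(3)[unfolded attached_def]
  have finE: "finite (A - nbr x)" using assms(2) by simp
  have "3 * r - 3 \<ge> 1" using assms(1) by simp
  then obtain U where U: "U \<subseteq> A - nbr x" "linked (3 * r - 3) U" "\<not> colourable U (d + s * (b + (2 * r - 2)))"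
    using highly_linked_subgraph[OF _ finE assms(8)] by blast
  have finU: "finite U" using U(1) finE finite_subset by blast
  have "2 * (2 * r - 2) \<le> s * (b + (2 * r - 2))"
    using assms(6) by (intro mult_le_mono) auto
  moreover have "d + s * (b + (2 * r - 2)) < card U"
    using U(3) colourable_card[OF finU] not_le by blast
  ultimately have cU: "3 * r - 2 < card U" using assms(1,7) by linarith
  have "r \<le> card {y. extendable r x A U y}"
    using many_extendable[OF assms(1,2) _ _ U(1,2) cU] att by blast
  moreover have "{y. extendable r x A U y} \<subseteq> A" by (auto simp: extendable_def)
  ultimately obtain Y where Y: "Y \<subseteq> {y. extendable r x A U y}" "card Y = s" "stable Y"
    using ramsey by blast
  have YA: "Y \<subseteq> A" using Y(1) by (auto simp: extendable_def)
  have "colourable {v\<in>U. \<forall>y\<in>Y. adj y v} d"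
    using common[OF YA Y(2,3)] by (rule colourable_mono) (use U(1) in auto)
  moreover have "finite Y" using YA assms(2) finite_subset by blast
  ultimately obtain y where y: "y \<in> Y" "\<not> colourable (U - nbr y) (b + (2 * r - 2))"
    using stable_split[of Y U d "b + (2 * r - 2)"] U(3) Y(2) by blast
  obtain T where T: "T \<subseteq> U" "card T \<le> 2 * r - 2" "y \<in> A" "y \<notin> U - T"
    "reachable x (A - U) (U - T) y" "r \<le> card (nbr y \<inter> (U - T))"
    using y(1) Y(1) unfolding extendable_def by blast
  then obtain ws where ws: "successively adj (x # ws @ [y])" "set ws \<subseteq> A - U"
    "\<forall>w\<in>set ws. \<forall>b\<in>U - T. \<not> adj w b"
    unfolding reachable_def by blast
  have finT: "finite T" using T(1) finU finite_subset by blast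
  have "\<exists>qs. ipath (last (ws @ [y]) # qs @ x # ps) \<and> set qs \<subseteq> set (butlast (ws @ [y])) \<and> last (ws @ [y]) \<notin> set qs"
  proof (rule shorten_walk)
    show "set (ws @ [y]) \<inter> set (x # ps) = {}" "ipath (x # ps)"
      using att ws(2) T(3) by auto
    show "\<not> adj v w" if "v \<in> set ps" "w \<in> set (ws @ [y])" for v w
      using att ws(2) T(3) that by auto
  qed (use ws(1) in auto)
  then obtain qs where qs: "ipath (y # qs @ x # ps)" "set qs \<subseteq> set ws" by auto
  \<comment> \<open>Dropping \<open>T\<close> lowers the linkedness from \<open>3 * r - 3\<close> to
    exactly the \<open>r - 1\<close> required by \<open>attached\<close>.\<close>
  have "linked (r - 1) (U - T)"
    using U(2) finT by (rule linked_Diff) (use T(2) assms(1) in linarith)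
  moreover have "set (y # qs @ x # ps) \<inter> (U - T) = {}"
    using T(4) qs(2) ws(2) att U(1) by auto
  moreover have "\<not> adj v a" if "v \<in> set (qs @ x # ps)" "a \<in> U - T" for v a
    using that qs(2) ws(3) att U(1) by auto
  ultimately have "attached r (qs @ x # ps) y (U - T)"
    using qs(1) T(6) unfolding attached_def by blast
  moreover have "\<not> colourable (U - T - nbr y) b"
  proof
    assume "colourable (U - T - nbr y) b"
    then have "colourable ((U - T - nbr y) \<union> T) (b + (2 * r - 2))"
      using colourable_card[OF finT T(2)] by (rule colourable_Un)
    then show False using y(2) colourable_mono[of _ _ "U - nbr y"] by blast
  qed
  ultimately show ?thesis
    using U(1) T(3) qs(2) ws(2) by (intro exI[of _ y] exI[of _ qs] exI[of _ "U - T"]) auto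
qed

text \<open>A component \<open>D\<close> of the non-neighbours of \<open>x\<close> that is not
  \<open>d\<close>-colourable yields three vertices at once. Some neighbour \<open>y\<close> of both
  \<open>x\<close> and \<open>D\<close> is not complete to \<open>D\<close>, and connectedness of
  \<open>D\<close> gives an edge from a neighbour \<open>u\<close> of \<open>y\<close> to a
  non-neighbour \<open>z\<close>.\<close>

lemma end_path:
  assumes "r \<ge> 1" "finite A" "attached r ps x A"
    and ramsey: "\<And>X. X \<subseteq> A \<Longrightarrow> r \<le> card X \<Longrightarrow> \<exists>Y\<subseteq>X. card Y = s \<and> stable Y"
    and common: "\<And>Y. Y \<subseteq> A \<Longrightarrow> card Y = s \<Longrightarrow> stable Y \<Longrightarrow> colourable {v\<in>A. \<forall>y\<in>Y. adj y v} d"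
    and "\<not> colourable (A - nbr x) d"
  shows "\<exists>z u y. ipath (z # u # y # x # ps) \<and> {z, u, y} \<subseteq> A"
proof -
  note att = assms(3)[unfolded attached_def]
  have finE: "finite (A - nbr x)" using assms(2) by simp
  obtain D where D: "D \<subseteq> A - nbr x" "conn D" "\<not> colourable D d"
    "\<And>u v. u \<in> D \<Longrightarrow> v \<in> A - nbr x - D \<Longrightarrow> \<not> adj u v"
    using component_not_colourable[OF finE assms(6)] by blast
  have "D \<noteq> {}" using D(3) by (auto simp: colourable_def)
  define N where "N = {v\<in>A - D. \<exists>u\<in>D. adj v u}"
  have Nx: "N \<subseteq> nbr x"
    using D(4) adj_commute unfolding N_def by blast
  have finN: "finite N" using assms(2) by (simp add: N_def)
  \<comment> \<open>Deleting fewer than \<open>r\<close> attachment vertices would leave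
    \<open>A\<close> connected, with a neighbour of \<open>x\<close> still present outside
    \<open>D\<close>; but no edge would leave \<open>D\<close>.\<close>
  have "r \<le> card N"
  proof (rule ccontr)
    assume *: "\<not> r \<le> card N"
    then have con: "conn (A - N)" using att finN unfolding linked_def by auto
    have "\<exists>u. u \<in> nbr x \<inter> A - N"
    proof (rule ccontr)
      assume "\<not> ?thesis"
      then have "card (nbr x \<inter> A) \<le> card N" using finN by (intro card_mono) auto
      then show False using att * by linarith
    qed
    then obtain u where u: "u \<in> nbr x \<inter> A - N" by blast
    obtain a where a: "a \<in> D" using \<open>D \<noteq> {}\<close> by blast
    have "D \<subseteq> A - N" using D(1) by (auto simp: N_def)
    moreover have "u \<in> A - N" "u \<notin> D" using u D(1) by auto
    ultimately obtain v w where "v \<in> D" "w \<in> A - N" "w \<notin> D" "adj v w"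
      using connD[OF con _ a] by blast
    then show False using adj_sym by (auto simp: N_def)
  qed
  then obtain Y where Y: "Y \<subseteq> N" "card Y = s" "stable Y"
    using ramsey[of N] by (auto simp: N_def)
  have "colourable {v\<in>A. \<forall>y\<in>Y. adj y v} d"
    using Y by (intro common) (auto simp: N_def)
  then have "\<not> D \<subseteq> {v\<in>A. \<forall>y\<in>Y. adj y v}"
    using D(3) colourable_mono by blast
  then obtain y b where y: "y \<in> Y" "b \<in> D" "\<not> adj y b" using D(1) by auto
  then obtain a where a: "a \<in> D" "adj y a" using Y(1) by (auto simp: N_def)
  obtain u z where uz: "u \<in> D \<inter> nbr y" "z \<in> D" "z \<notin> D \<inter> nbr y" "adj u z"
    using connD[OF D(2), of "D \<inter> nbr y" a b] a y by auto
  have yA: "y \<in> A" "y \<notin> D" "adj x y" using y(1) Y(1) Nx by (auto simp: N_def)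
  have "ipath (z # u # y # x # ps)"
    using att uz yA D(1) adj_commute by auto
  then show ?thesis using uz yA D(1) by blast
qed

text \<open>Needing more than this many colours on the non-neighbours of the current end forces
  \<open>j + 3\<close> further vertices: \<open>j\<close> rounds of \<open>extend_path\<close> add
  at least one each, and \<open>end_path\<close> adds three.\<close>

primrec path_bound :: "nat \<Rightarrow> nat \<Rightarrow> nat \<Rightarrow> nat \<Rightarrow> nat" where
  "path_bound r s d 0 = d"
| "path_bound r s d (Suc j) = d + s * (path_bound r s d j + (2 * r - 2)) + 4 * (3 * r - 3)"

lemma continue_path:
  assumes "r \<ge> 2" "finite A" "attached r ps x A"
    and "\<And>X. X \<subseteq> A \<Longrightarrow> r \<le> card X \<Longrightarrow> \<exists>Y\<subseteq>X. card Y = s \<and> stable Y"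
    and "\<And>Y. Y \<subseteq> A \<Longrightarrow> card Y = s \<Longrightarrow> stable Y \<Longrightarrow> colourable {v\<in>A. \<forall>y\<in>Y. adj y v} d"
    and "s \<ge> 2" "d + 1 \<ge> r"
    and "\<not> colourable (A - nbr x) (path_bound r s d j)"
  shows "\<exists>zs. ipath zs \<and> set zs \<subseteq> A \<union> set (x # ps) \<and> length ps + j + 4 \<le> length zs"
  using assms
proof (induction j arbitrary: A x ps)
  case 0
  have "\<exists>z u y. ipath (z # u # y # x # ps) \<and> {z, u, y} \<subseteq> A"
    using 0(1,8) by (intro end_path[OF _ 0(2-5)]) simp_all
  then obtain z u y where "ipath (z # u # y # x # ps)" "{z, u, y} \<subseteq> A" by blast
  then show ?case
    by (intro exI[of _ "z # u # y # x # ps"]) auto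
next
  case (Suc j)
  have "\<exists>y qs A'. attached r (qs @ x # ps) y A' \<and> A' \<subseteq> A \<and> y \<in> A \<and> set qs \<subseteq> A \<and>
      \<not> colourable (A' - nbr y) (path_bound r s d j)"
    using Suc.prems(8) by (intro extend_path[OF Suc.prems(1-7)]) simp_all
  then obtain y qs A' where *: "attached r (qs @ x # ps) y A'" "A' \<subseteq> A" "y \<in> A" "set qs \<subseteq> A"
    "\<not> colourable (A' - nbr y) (path_bound r s d j)"
    by blast
  have "\<exists>zs. ipath zs \<and> set zs \<subseteq> A' \<union> set (y # qs @ x # ps) \<and> length (qs @ x # ps) + j + 4 \<le> length zs"
  proof (rule Suc.IH[OF Suc.prems(1) _ *(1) _ _ Suc.prems(6,7) *(5)])
    show "finite A'" using *(2) Suc.prems(2) finite_subset by blast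
    show "\<exists>Y\<subseteq>X. card Y = s \<and> stable Y" if "X \<subseteq> A'" "r \<le> card X" for X
      using Suc.prems(4)[of X] that *(2) by blast
    show "colourable {v\<in>A'. \<forall>y\<in>Y. adj y v} d" if "Y \<subseteq> A'" "card Y = s" "stable Y" for Y
      by (rule colourable_mono[OF Suc.prems(5)[of Y]]) (use that *(2) in auto)
  qed
  then obtain zs where "ipath zs" "set zs \<subseteq> A' \<union> set (y # qs @ x # ps)" "length (qs @ x # ps) + j + 4 \<le> length zs"
    by blast
  then show ?case using *(2-4) by (intro exI[of _ zs]) auto
qed

text \<open>Starts the path. For positive \<open>J\<close> the first vertex is chosen by
  \<open>stable_split\<close> inside a linked set, within the budget of one round, and only this
  vertex is removed instead of a set \<open>T\<close>.\<close>

lemma long_ipath: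
  assumes "r \<ge> 2" "finite V"
    and ramsey: "\<And>X. X \<subseteq> V \<Longrightarrow> r \<le> card X \<Longrightarrow> \<exists>Y\<subseteq>X. card Y = s \<and> stable Y"
    and common: "\<And>Y. Y \<subseteq> V \<Longrightarrow> card Y = s \<Longrightarrow> stable Y \<Longrightarrow> colourable {v\<in>V. \<forall>y\<in>Y. adj y v} d"
    and "s \<ge> 2" "d + 1 \<ge> r"
    and "\<not> colourable V (path_bound r s d J)"
  shows "\<exists>zs. ipath zs \<and> set zs \<subseteq> V \<and> J + 3 \<le> length zs"
proof (cases J)
  case 0
  then have "\<not> colourable V d" using assms(7) by simp
  then obtain D where D: "D \<subseteq> V" "conn D" "\<not> colourable D d"
    by (rule component_not_colourable[OF assms(2)]) (rule that)
  have "finite D" using D(1) assms(2) finite_subset by blast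
  then have "d < card D" using colourable_card D(3) not_le by blast
  then obtain Y where Y: "Y \<subseteq> D" "card Y = s" "stable Y"
    using ramsey[of D] D(1) assms(6) by auto
  have "finite Y" using Y(1) \<open>finite D\<close> finite_subset by blast
  moreover have "\<not> card Y \<le> Suc 0" using Y(2) assms(5) by simp
  ultimately obtain y b where y: "y \<in> Y" "b \<in> Y" "y \<noteq> b"
    using card_le_Suc0_iff_eq by blast
  then have "\<not> adj y b" "y \<in> D" "b \<in> D" using Y by (auto simp: stable_def)
  \<comment> \<open>An edge leaving the closed neighbourhood of \<open>y\<close> cannot start at
    \<open>y\<close> itself, so it completes an induced path on three vertices.\<close>
  obtain u w where uw: "u \<in> insert y (D \<inter> nbr y)" "w \<in> D" "w \<notin> insert y (D \<inter> nbr y)" "adj u w"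
    using connD[OF D(2), of "insert y (D \<inter> nbr y)" y b] \<open>\<not> adj y b\<close> \<open>y \<in> D\<close> \<open>b \<in> D\<close> y(3) by auto
  then have "ipath [y, u, w]" by auto
  moreover have "u \<in> D" using uw(1) \<open>y \<in> D\<close> by auto
  ultimately show ?thesis
    using uw(2) \<open>y \<in> D\<close> D(1) 0 by (intro exI[of _ "[y, u, w]"]) auto
next
  case (Suc j)
  have "3 * r - 3 \<ge> 1" using assms(1) by simp
  moreover have "\<not> colourable V (d + s * (path_bound r s d j + (2 * r - 2)) + 4 * (3 * r - 3))"
    using assms(7) Suc by simp
  ultimately obtain U where U: "U \<subseteq> V" "linked (3 * r - 3) U"
    "\<not> colourable U (d + s * (path_bound r s d j + (2 * r - 2)))"
    using highly_linked_subgraph[OF _ assms(2)] by blast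
  have finU: "finite U" using U(1) assms(2) finite_subset by blast
  have "2 * (2 * r - 2) \<le> s * (path_bound r s d j + (2 * r - 2))"
    using assms(5) by (intro mult_le_mono) auto
  moreover have "d + s * (path_bound r s d j + (2 * r - 2)) < card U"
    using U(3) colourable_card[OF finU] not_le by blast
  ultimately have cU: "3 * r - 2 < card U" using assms(1,6) by linarith
  then have "r \<le> card U" using assms(1) by linarith
  then obtain Y where Y: "Y \<subseteq> U" "card Y = s" "stable Y"
    using ramsey[OF U(1)] by blast
  have "Y \<subseteq> V" using Y(1) U(1) by blast
  have "colourable {v\<in>U. \<forall>y\<in>Y. adj y v} d"
    using common[OF \<open>Y \<subseteq> V\<close> Y(2,3)] by (rule colourable_mono) (use U(1) in auto)
  moreover have "finite Y" using Y(1) finU finite_subset by blast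
  ultimately obtain y where y: "y \<in> Y" "\<not> colourable (U - nbr y) (path_bound r s d j + (2 * r - 2))"
    using stable_split[of Y U d "path_bound r s d j + (2 * r - 2)"] U(3) Y(2) by blast
  define A where "A = U - {y}"
  have yU: "y \<in> U" using y(1) Y(1) by blast
  have deg: "3 * r - 3 < card (nbr y \<inter> U)"
    using linked_degree[OF U(2) finU yU] cU assms(1) by simp
  have "nbr y \<inter> A = nbr y \<inter> U" using adj_irrefl by (auto simp: A_def)
  then have "r \<le> card (nbr y \<inter> A)" using deg assms(1) by simp
  moreover have "linked (r - 1) A"
    unfolding A_def using U(2) by (rule linked_Diff) (use assms(1) in auto)
  ultimately have att: "attached r [] y A"
    unfolding attached_def by (auto simp: A_def)
  have AV: "A \<subseteq> V" using U(1) by (auto simp: A_def)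
  have "\<not> colourable (A - nbr y) (path_bound r s d j)"
  proof
    assume "colourable (A - nbr y) (path_bound r s d j)"
    moreover have "colourable {y} (2 * r - 2)"
      using assms(1) by (intro colourable_card) auto
    ultimately have "colourable (A - nbr y \<union> {y}) (path_bound r s d j + (2 * r - 2))"
      by (rule colourable_Un)
    then show False using y(2) colourable_mono[of _ _ "U - nbr y"] by (auto simp: A_def)
  qed
  then have "\<exists>zs. ipath zs \<and> set zs \<subseteq> A \<union> set [y] \<and> length ([] :: 'a list) + j + 4 \<le> length zs"
  proof (intro continue_path[OF assms(1) _ att _ _ assms(5,6)])
    show "finite A" using finU by (simp add: A_def)
    show "\<exists>Y\<subseteq>X. card Y = s \<and> stable Y" if "X \<subseteq> A" "r \<le> card X" for X
      using ramsey[of X] that AV by blast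
    show "colourable {v\<in>A. \<forall>y\<in>Y. adj y v} d" if "Y \<subseteq> A" "card Y = s" "stable Y" for Y
      by (rule colourable_mono[OF common[of Y]]) (use that AV in auto)
  qed
  then obtain zs where "ipath zs" "set zs \<subseteq> A \<union> {y}" "j + 4 \<le> length zs" by auto
  then show ?thesis using yU U(1) Suc AV by (intro exI[of _ zs]) auto
qed

section \<open>Induction on the number of parts and the closed form of the bound\<close>

definition multipartite :: "nat \<Rightarrow> nat \<Rightarrow> 'a set \<Rightarrow> bool" where
  "multipartite m s W \<longleftrightarrow> (\<exists>X. (\<forall>i<m. X i \<subseteq> W \<and> card (X i) = s \<and> stable (X i)) \<and>
     (\<forall>i<m. \<forall>j<m. i \<noteq> j \<longrightarrow> (\<forall>u\<in>X i. \<forall>v\<in>X j. adj u v)))"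

text \<open>The index is one less than the number of excluded parts. Excluding a single part means
  that there is no stable \<open>s\<close>-set, hence fewer than \<open>r\<close> vertices.\<close>

primrec colour_bound :: "nat \<Rightarrow> nat \<Rightarrow> nat \<Rightarrow> nat \<Rightarrow> nat" where
  "colour_bound r s J 0 = r - 1"
| "colour_bound r s J (Suc m) = path_bound r s (colour_bound r s J m) J"

text \<open>Supplies the condition \<open>d + 1 >= r\<close> of \<open>long_ipath\<close>, by which
  sets that are not \<open>d\<close>-colourable have at least \<open>r\<close> vertices.\<close>

lemma colour_bound_ge: "s \<ge> 1 \<Longrightarrow> r \<le> colour_bound r s J m + 1"
proof (induction m)
  case (Suc m)
  have "d \<le> path_bound r s d J" for d by (cases J) simp_all
  then have "colour_bound r s J m \<le> colour_bound r s J (Suc m)" by simp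
  then show ?case using Suc by linarith
qed simp

lemma multipartite_Suc:
  assumes "Y \<subseteq> W" "card Y = s" "stable Y" "multipartite m s {v\<in>W. \<forall>y\<in>Y. adj y v}"
  shows "multipartite (Suc m) s W"
proof -
  obtain X where X0: "\<forall>i<m. X i \<subseteq> {v\<in>W. \<forall>y\<in>Y. adj y v} \<and> card (X i) = s \<and> stable (X i)"
    "\<forall>i<m. \<forall>j<m. i \<noteq> j \<longrightarrow> (\<forall>u\<in>X i. \<forall>v\<in>X j. adj u v)"
    using assms(4) unfolding multipartite_def by (elim exE conjE) (rule that)
  note X = X0(1)[rule_format] X0(2)[rule_format]
  define X' where "X' i = (if i = m then Y else X i)" for i
  have "X' i \<subseteq> W \<and> card (X' i) = s \<and> stable (X' i)" if "i < Suc m" for i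
    using X(1)[of i] assms(1-3) that by (auto simp: X'_def less_Suc_eq)
  moreover have "adj u v" if "i < Suc m" "j < Suc m" "i \<noteq> j" "u \<in> X' i" "v \<in> X' j" for i j u v
  proof -
    consider "i < m" "j < m" | "i = m" "j < m" | "i < m" "j = m"
      using \<open>i < Suc m\<close> \<open>j < Suc m\<close> \<open>i \<noteq> j\<close> by linarith
    then show ?thesis
    proof cases
      case 1
      then show ?thesis using X(2)[of i j u v] that by (simp add: X'_def)
    next
      case 2
      then show ?thesis using X(1)[of j] that by (auto simp: X'_def)
    next
      case 3
      then have "adj v u" using X(1)[of i] that by (auto simp: X'_def)
      then show ?thesis by (rule adj_sym)
    qed
  qed
  ultimately show ?thesis unfolding multipartite_def by (intro exI[of _ X']) blast
qed

lemma colourable_colour_bound: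
  assumes "finite W" "s \<ge> 2"
    and "\<And>X. X \<subseteq> W \<Longrightarrow> r \<le> card X \<Longrightarrow> \<exists>Y\<subseteq>X. card Y = s \<and> stable Y"
    and "\<And>zs. ipath zs \<Longrightarrow> set zs \<subseteq> W \<Longrightarrow> length zs < J + 3"
    and "\<not> multipartite (Suc m) s W" "r \<ge> 1"
  shows "colourable W (colour_bound r s J m)"
  using assms
proof (induction m arbitrary: W)
  case 0
  have "\<not> r \<le> card W"
  proof
    assume "r \<le> card W"
    then obtain Y where "Y \<subseteq> W" "card Y = s" "stable Y" using 0(3)[of W] by blast
    then show False using 0(5) by (auto simp: multipartite_def)
  qed
  then show ?case using colourable_card[OF 0(1), of "r - 1"] by simp
next
  case (Suc m)
  show ?case
  \<comment> \<open>A nonempty \<open>W\<close> excludes \<open>r = 1\<close>, because a single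
    vertex contains no stable set of size \<open>s >= 2\<close>; the path argument needs
    \<open>r >= 2\<close>.\<close>
  proof (cases "W = {}")
    case True
    then show ?thesis by (simp add: colourable_def)
  next
    case False
    then obtain v where v: "v \<in> W" by blast
    have "r \<noteq> 1"
    proof
      assume "r = 1"
      then obtain Y where "Y \<subseteq> {v}" "card Y = s" using Suc.prems(3)[of "{v}"] v by auto
      then show False using card_mono[of "{v}" Y] Suc.prems(2) by simp
    qed
    then have r: "r \<ge> 2" using Suc.prems(6) by simp
    have common: "colourable {v\<in>W. \<forall>y\<in>Y. adj y v} (colour_bound r s J m)"
      if Y: "Y \<subseteq> W" "card Y = s" "stable Y" for Y
    proof (rule Suc.IH)
      show "\<exists>Y\<subseteq>X. card Y = s \<and> stable Y" if "X \<subseteq> {v\<in>W. \<forall>y\<in>Y. adj y v}" "r \<le> card X" for X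
        using Suc.prems(3)[of X] that by blast
      show "length zs < J + 3" if "ipath zs" "set zs \<subseteq> {v\<in>W. \<forall>y\<in>Y. adj y v}" for zs
        using Suc.prems(4)[of zs] that by blast
      show "\<not> multipartite (Suc m) s {v\<in>W. \<forall>y\<in>Y. adj y v}"
        using multipartite_Suc[OF Y] Suc.prems(5) by blast
    qed (use Suc.prems in auto)
    have ge: "r \<le> colour_bound r s J m + 1"
      using Suc.prems(2) by (intro colour_bound_ge) simp
    show ?thesis
    proof (rule ccontr)
      assume "\<not> ?thesis"
      then have "\<not> colourable W (path_bound r s (colour_bound r s J m) J)" by simp
      then obtain zs where "ipath zs" "set zs \<subseteq> W" "J + 3 \<le> length zs"
        using long_ipath[OF r Suc.prems(1,3) common Suc.prems(2) ge] by blast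
      then show False using Suc.prems(4)[of zs] by simp
    qed
  qed
qed

text \<open>The recurrence in the form \<open>P' = d + s * P + L\<close>, multiplied by \<open>t = s - 1\<close> to avoid the
  geometric sum.\<close>

lemma path_bound_eq:
  fixes r t d :: nat
  defines "L \<equiv> Suc t * (2 * r - 2) + 4 * (3 * r - 3)"
  shows "t * path_bound r (Suc t) d j + (d + L) = Suc t ^ j * (t * d + (d + L))"
proof (induction j)
  case (Suc j)
  have "path_bound r (Suc t) d (Suc j) = d + (Suc t * path_bound r (Suc t) d j + L)"
    by (simp only: path_bound.simps L_def add_mult_distrib2 ac_simps)
  then have "t * path_bound r (Suc t) d (Suc j) + (d + L) =
      t * (d + (Suc t * path_bound r (Suc t) d j + L)) + (d + L)"
    by (simp only:)
  also have "\<dots> = Suc t * (t * path_bound r (Suc t) d j + (d + L))"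
    by (simp add: algebra_simps)
  finally have "t * path_bound r (Suc t) d (Suc j) + (d + L) = Suc t * (t * path_bound r (Suc t) d j + (d + L))" .
  then show ?case by (simp only: power_Suc mult.assoc Suc)
qed simp

text \<open>Shifting by the constant \<open>4 * s * r + 1\<close> turns the affine recurrence into a
  purely multiplicative estimate, which can be iterated over the number of parts.\<close>

lemma path_bound_le:
  assumes "s \<ge> 2"
  shows "path_bound r s d J + (4 * s * r + 1) \<le> 2 * s ^ J * (d + (4 * s * r + 1))"
proof -
  obtain t where t: "s = Suc t" "t \<ge> 1" using assms by (cases s) auto
  define L A p where "L = s * (2 * r - 2) + 4 * (3 * r - 3)" and "A = 4 * s * r + 1" and "p = s ^ J - 1"
  have p: "s ^ J = Suc p" using assms by (simp add: p_def)
  \<comment> \<open>With \<open>s = t + 1\<close> this is \<open>2 * s + 12 <= 8 * s * t\<close>,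
    the numerical fact behind \<open>L <= 2 * (t * A)\<close>.\<close>
  have "14 \<le> 8 * (t * t) + 6 * t" using t(2) mult_le_mono[OF t(2) t(2)] by linarith
  then have "2 * s + 12 \<le> 8 * s * t" by (simp add: t(1) algebra_simps)
  then have "(2 * s + 12) * r \<le> 8 * s * t * r" by (rule mult_le_mono1)
  moreover have "L \<le> s * (2 * r) + 4 * (3 * r)"
    unfolding L_def by (intro add_mono mult_le_mono) auto
  ultimately have L: "L \<le> 2 * (t * A)" by (simp add: A_def algebra_simps)
  have "t * path_bound r s d J + (d + L) = Suc p * (t * d + (d + L))"
    using path_bound_eq[of t r d J] p by (simp only: t(1) L_def)
  then have eq: "t * path_bound r s d J = p * (t * d) + p * d + p * L + t * d"
    by (simp add: add_mult_distrib2)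
  have "p * L \<le> p * (2 * (t * A))" using L by (rule mult_le_mono2)
  then have pL: "p * L \<le> 2 * (p * (t * A))" by (simp only: mult.left_commute)
  have "d \<le> t * d" using t(2) by (cases t) auto
  then have pd: "p * d \<le> p * (t * d)" by (rule mult_le_mono2)
  have "t * (2 * Suc p * (d + A)) = 2 * (p * (t * d)) + 2 * (t * d) + 2 * (p * (t * A)) + 2 * (t * A)"
    by (simp add: algebra_simps)
  then have "t * (path_bound r s d J + A) \<le> t * (2 * Suc p * (d + A))"
    using eq pL pd by (simp only: add_mult_distrib2)
  then have "path_bound r s d J + A \<le> 2 * Suc p * (d + A)"
    by (rule mult_left_le_imp_le) (use t(2) in simp)
  then show ?thesis by (simp only: A_def p)
qed

text \<open>The base case is the identity (r-1) + (4sr+1) = (4s+1)r, which explains the factor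
  \<open>4 * s + 1\<close>. The positive shift makes the final inequality strict.\<close>

lemma colour_bound_le:
  assumes "s \<ge> 2" "r \<ge> 1"
  shows "colour_bound r s J m + (4 * s * r + 1) \<le> (2 * s ^ J) ^ m * (4 * s + 1) * r"
proof (induction m)
  case 0
  then show ?case using assms(2) by (simp add: algebra_simps)
next
  case (Suc m)
  have "colour_bound r s J (Suc m) + (4 * s * r + 1) \<le> 2 * s ^ J * (colour_bound r s J m + (4 * s * r + 1))"
    using path_bound_le[OF assms(1)] by simp
  also have "\<dots> \<le> 2 * s ^ J * ((2 * s ^ J) ^ m * (4 * s + 1) * r)"
    using Suc by (rule mult_le_mono2)
  finally show ?case by (simp only: power_Suc mult.assoc)
qed

end

section \<open>From the locale back to graphs: induced copies and Ramsey numbers\<close>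

text \<open>\<open>graph_iso\<close> maps the subgraph of \<open>G\<close> to \<open>H\<close>,
  while copies are constructed below as maps out of \<open>H\<close>; the inverse mediates.\<close>

lemma not_is_freeI:
  assumes "bij_betw g (verts H) S" "S \<subseteq> verts G" "fin_simple_graph G"
    and "\<And>p q. p \<in> verts H \<Longrightarrow> q \<in> verts H \<Longrightarrow> {p, q} \<in> edges H \<longleftrightarrow> {g p, g q} \<in> edges G"
  shows "\<not> is_free H G"
proof -
  have "graph_iso (induced_subgraph G S) H"
    unfolding graph_iso_def
  proof (intro exI[of _ "inv_into (verts H) g"] conjI ballI)
    show "bij_betw (inv_into (verts H) g) (verts (induced_subgraph G S)) (verts H)"
      using bij_betw_inv_into[OF assms(1)] by (simp add: induced_subgraph_def)
    fix u v assume "u \<in> verts (induced_subgraph G S)" "v \<in> verts (induced_subgraph G S)"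
    then have uv: "u \<in> S" "v \<in> S" by (auto simp: induced_subgraph_def)
    have *: "inv_into (verts H) g w \<in> verts H" "g (inv_into (verts H) g w) = w" if "w \<in> S" for w
      using that assms(1) by (auto simp: bij_betw_def inv_into_into f_inv_into_f)
    have "{u, v} \<in> [S]\<^bsup>2\<^esup>" if "{u, v} \<in> edges G"
      using that uv assms(3) by (auto simp: fin_simple_graph_def nsets_def)
    then have "{u, v} \<in> edges (induced_subgraph G S) \<longleftrightarrow> {u, v} \<in> edges G"
      by (auto simp: induced_subgraph_def)
    then show "{u, v} \<in> edges (induced_subgraph G S) \<longleftrightarrow>
        {inv_into (verts H) g u, inv_into (verts H) g v} \<in> edges H"
      using assms(4)[OF *(1)[OF uv(1)] *(1)[OF uv(2)]] *(2)[OF uv(1)] *(2)[OF uv(2)] by simp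
  qed
  then show ?thesis using assms(2) unfolding is_free_def by blast
qed

lemma complement_multipartite_edge:
  assumes "p \<in> {..<m} \<times> {..<s}" "q \<in> {..<m} \<times> {..<s}"
  shows "{p, q} \<in> edges (complement (disjoint_copies m (complete_graph s))) \<longleftrightarrow> fst p \<noteq> fst q"
proof -
  obtain i a j b where pq: "p = (i, a)" "q = (j, b)" by fastforce
  have 1: "{p, q} \<in> edges (disjoint_copies m (complete_graph s)) \<longleftrightarrow> i = j \<and> a \<noteq> b"
  proof
    assume "{p, q} \<in> edges (disjoint_copies m (complete_graph s))"
    then obtain l e where e: "e \<in> [{..<s}]\<^bsup>2\<^esup>" "{p, q} = Pair l ` e"
      by (auto simp: disjoint_copies_def complete_graph_def)
    then obtain x y where "e = {x, y}" "x \<noteq> y" by (auto simp: nsets_def card_2_iff)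
    then show "i = j \<and> a \<noteq> b" using e(2) pq by (auto simp: doubleton_eq_iff)
  next
    assume *: "i = j \<and> a \<noteq> b"
    then have "{a, b} \<in> [{..<s}]\<^bsup>2\<^esup>" using assms pq by (auto simp: nsets_def card_2_iff)
    then show "{p, q} \<in> edges (disjoint_copies m (complete_graph s))"
      using * pq assms by (auto simp: disjoint_copies_def complete_graph_def intro!: bexI[of _ j] image_eqI[of _ _ "{a, b}"])
  qed
  have "{p, q} \<in> [{..<m} \<times> {..<s}]\<^bsup>2\<^esup> \<longleftrightarrow> p \<noteq> q"
    using assms by (auto simp: nsets_def card_2_iff)
  then show ?thesis
    using 1 pq by (auto simp: complement_def disjoint_copies_def complete_graph_def)
qed

text \<open>\<open>ramsey_number\<close> speaks of graphs on naturals of exactly that order, so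
  \<open>X\<close> is cut down to \<open>r\<close> vertices and transported along a bijection. The
  clique alternative would exceed the clique number.\<close>

lemma ramsey_number_stable:
  assumes G: "fin_simple_graph G" and X: "X \<subseteq> verts G" "ramsey_number s (clique_number G + 1) \<le> card X"
  shows "\<exists>Y\<subseteq>X. card Y = s \<and> indep Y (edges G)"
proof -
  define r where "r = ramsey_number s (clique_number G + 1)"
  obtain X' where X': "X' \<subseteq> X" "card X' = r" "finite X'"
    using obtain_subset_with_card_n[OF X(2)] unfolding r_def by blast
  obtain h where h: "bij_betw h {0..<r} X'" using ex_bij_betw_nat_finite[OF X'(3)] X'(2) by auto
  have inj: "inj_on h {0..<r}" using h by (simp add: bij_betw_def)
  define H :: "nat graph" where "H = ({0..<r}, {e \<in> [{0..<r}]\<^bsup>2\<^esup>. h ` e \<in> edges G})"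
  have "fin_simple_graph H" "card (verts H) = r" by (auto simp: H_def fin_simple_graph_def)
  then have "(\<exists>S\<subseteq>verts H. card S = s \<and> indep S (edges H)) \<or>
      (\<exists>K\<subseteq>verts H. card K = clique_number G + 1 \<and> clique K (edges H))"
    by (intro mp[OF spec[OF conjunct2[OF ramsey_number_works[of s "clique_number G + 1"]], of H]])
      (simp add: r_def)
  moreover have "verts H = {0..<r}" by (simp add: H_def)
  ultimately have "(\<exists>S\<subseteq>{0..<r}. card S = s \<and> indep S (edges H)) \<or>
      (\<exists>K\<subseteq>{0..<r}. card K = clique_number G + 1 \<and> clique K (edges H))"
    by (simp only:)
  then consider S where "S \<subseteq> {0..<r}" "card S = s" "indep S (edges H)"
    | K where "K \<subseteq> {0..<r}" "card K = clique_number G + 1" "clique K (edges H)"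
    by blast
  then show ?thesis
  proof cases
    case 1
    have "card (h ` S) = s" using 1(1,2) inj by (metis card_image inj_on_subset)
    moreover have "h ` S \<subseteq> X" using 1(1) h X'(1) by (auto simp: bij_betw_def)
    moreover have "indep (h ` S) (edges G)"
      unfolding indep_def
    proof (intro ballI impI)
      fix u v assume "u \<in> h ` S" "v \<in> h ` S" "u \<noteq> v"
      then obtain i j where ij: "i \<in> S" "j \<in> S" "u = h i" "v = h j" "i \<noteq> j" by auto
      then have "{i, j} \<in> [{0..<r}]\<^bsup>2\<^esup>" using 1(1) by (auto simp: nsets_def card_2_iff)
      then show "{u, v} \<notin> edges G" using 1(3) ij by (auto simp: indep_def H_def)
    qed
    ultimately show ?thesis by blast
  next
    case 2
    have "card (h ` K) = clique_number G + 1" using 2(1,2) inj by (metis card_image inj_on_subset)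
    moreover have "h ` K \<subseteq> verts G" using 2(1) h X'(1) X(1) by (auto simp: bij_betw_def)
    moreover have "clique (h ` K) (edges G)"
      using 2(3) unfolding clique_def H_def by auto
    ultimately have "clique_number G + 1 \<le> clique_number G"
      using clique_number_works(2)[OF G, of "h ` K"] by simp
    then show ?thesis by simp
  qed
qed

theorem theorem1p4:
  fixes m s k :: nat and G :: "'a graph"
  assumes "m \<ge> 1" and "s \<ge> 2" and "k \<ge> 3"
    and "fin_simple_graph G"
    and "is_free (path_graph k) G"
    and "is_free (complement (disjoint_copies m (complete_graph s))) G"
  shows "chromatic_number G <
    (2 * s ^ (k - 3)) ^ (m - 1) * (4 * s + 1) * ramsey_number s (clique_number G + 1)"
proof -
  note G = \<open>fin_simple_graph G\<close>
  define r where "r = ramsey_number s (clique_number G + 1)"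
  have r: "r \<ge> 1" using ramsey_number_works unfolding r_def by blast
  have edge: "u \<in> verts G" "v \<in> verts G" "u \<noteq> v" if "{u, v} \<in> edges G" for u v
  proof -
    have "{u, v} \<in> [verts G]\<^bsup>2\<^esup>" using that G unfolding fin_simple_graph_def by blast
    then show "u \<in> verts G" "v \<in> verts G" "u \<noteq> v" by (auto simp: nsets_def)
  qed
  interpret adjacency "\<lambda>u v. {u, v} \<in> edges G"
  proof
    show "{v, v} \<notin> edges G" for v using edge(3)[of v v] by blast
  qed (simp add: insert_commute)
  have "colourable (verts G) (colour_bound r s (k - 3) (m - 1))"
  proof (rule colourable_colour_bound[OF _ \<open>s \<ge> 2\<close> _ _ _ r])
    show "finite (verts G)" using G by (simp add: fin_simple_graph_def)
    show "\<exists>Y\<subseteq>X. card Y = s \<and> stable Y" if "X \<subseteq> verts G" "r \<le> card X" for X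
      using ramsey_number_stable[OF G that(1), of s] that(2) edge(3)
      unfolding r_def stable_def indep_def by metis
    show "length zs < k - 3 + 3" if zs: "ipath zs" "set zs \<subseteq> verts G" for zs
    proof (rule ccontr)
      assume "\<not> length zs < k - 3 + 3"
      \<comment> \<open>A suffix of an induced path is induced; this one has exactly
        \<open>k\<close> vertices.\<close>
      define ys where "ys = drop (length zs - k) zs"
      have ys: "ipath ys" "length ys = k" "set ys \<subseteq> verts G"
        using ipath_drop zs \<open>\<not> length zs < k - 3 + 3\<close> \<open>k \<ge> 3\<close> set_drop_subset[of "length zs - k" zs]
        by (auto simp: ys_def)
      have "\<not> is_free (path_graph k) G"
      proof (rule not_is_freeI[OF _ ys(3) G])
        show "bij_betw ((!) ys) (verts (path_graph k)) (set ys)"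
          using bij_betw_nth[OF ipath_distinct[OF ys(1)]] ys(2) by (simp add: path_graph_def)
        fix i j assume "i \<in> verts (path_graph k)" "j \<in> verts (path_graph k)"
        then have "i < k" "j < k" by (auto simp: path_graph_def)
        then show "{i, j} \<in> edges (path_graph k) \<longleftrightarrow> {ys ! i, ys ! j} \<in> edges G"
          using ipath_nth[OF ys(1), of i j] ys(2) by (auto simp: path_graph_def doubleton_eq_iff)
      qed
      then show False using \<open>is_free (path_graph k) G\<close> by simp
    qed
    show "\<not> multipartite (Suc (m - 1)) s (verts G)"
    proof
      assume "multipartite (Suc (m - 1)) s (verts G)"
      then have "multipartite m s (verts G)" using \<open>m \<ge> 1\<close> by simp
      then obtain X where X0: "\<forall>i<m. X i \<subseteq> verts G \<and> card (X i) = s \<and> stable (X i)"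
        "\<forall>i<m. \<forall>j<m. i \<noteq> j \<longrightarrow> (\<forall>u\<in>X i. \<forall>v\<in>X j. {u, v} \<in> edges G)"
        unfolding multipartite_def by (elim exE conjE) (rule that)
      then have X: "X i \<subseteq> verts G" "card (X i) = s" "stable (X i)" if "i < m" for i
        using that by auto
      note X_adj = X0(2)[rule_format]
      have "\<exists>f. bij_betw f {..<s} (X i)" if "i < m" for i
      proof -
        have "finite (X i)" using X(2)[OF that] \<open>s \<ge> 2\<close> by (metis card.infinite not_numeral_le_zero)
        then show ?thesis
          using ex_bij_betw_nat_finite[of "X i"] X(2)[OF that] by (simp add: lessThan_atLeast0)
      qed
      then obtain f where f: "\<And>i. i < m \<Longrightarrow> bij_betw (f i) {..<s} (X i)" by metis
      define g where "g p = f (fst p) (snd p)" for p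
      have gX: "g p \<in> X (fst p)" if "p \<in> {..<m} \<times> {..<s}" for p
        using that bij_betwE[OF f[of "fst p"]] by (auto simp: g_def)
      have adj: "{g p, g q} \<in> edges G \<longleftrightarrow> fst p \<noteq> fst q"
        if "p \<in> {..<m} \<times> {..<s}" "q \<in> {..<m} \<times> {..<s}" for p q
      proof (cases "fst p = fst q")
        case True
        then show ?thesis using X(3)[of "fst p"] gX[OF that(1)] gX[OF that(2)] that
          by (auto simp: stable_def)
      next
        case False
        then show ?thesis using X_adj[OF _ _ False gX[OF that(1)] gX[OF that(2)]] that by auto
      qed
      have "\<not> is_free (complement (disjoint_copies m (complete_graph s))) G"
      proof (rule not_is_freeI[OF _ _ G])
        \<comment> \<open>Vertices of different parts are adjacent, hence distinct, so equal images
          come from the same part.\<close>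
        have "p = q" if pq: "p \<in> {..<m} \<times> {..<s}" "q \<in> {..<m} \<times> {..<s}" "g p = g q" for p q
        proof -
          have "{g p, g q} \<notin> edges G" using edge(3)[of "g p" "g q"] pq(3) by auto
          then have *: "fst p = fst q" using adj[OF pq(1,2)] by simp
          have p: "fst p < m" "snd p \<in> {..<s}" "snd q \<in> {..<s}" using pq by auto
          have "f (fst p) (snd p) = f (fst p) (snd q)" using pq(3) * by (simp add: g_def)
          then have "snd p = snd q"
            using inj_onD[OF bij_betw_imp_inj_on[OF f[OF p(1)]]] p by blast
          then show ?thesis using * by (simp add: prod_eq_iff)
        qed
        then show "bij_betw g (verts (complement (disjoint_copies m (complete_graph s)))) (g ` ({..<m} \<times> {..<s}))"
          by (auto simp: bij_betw_def inj_on_def complement_def disjoint_copies_def complete_graph_def)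
        show "g ` ({..<m} \<times> {..<s}) \<subseteq> verts G" using gX X(1) by fastforce
      qed (use adj complement_multipartite_edge in \<open>auto simp: complement_def disjoint_copies_def complete_graph_def\<close>)
      then show False using \<open>is_free (complement (disjoint_copies m (complete_graph s))) G\<close> by simp
    qed
  qed
  then have "\<exists>c. proper_colouring G (colour_bound r s (k - 3) (m - 1)) c"
    using edge unfolding colourable_def proper_colouring_def by blast
  then have "chromatic_number G \<le> colour_bound r s (k - 3) (m - 1)"
    unfolding chromatic_number_def by (rule Least_le)
  also have "\<dots> < (2 * s ^ (k - 3)) ^ (m - 1) * (4 * s + 1) * r"
    using colour_bound_le[OF \<open>s \<ge> 2\<close> r, of "k - 3" "m - 1"] by linarith
  finally show ?thesis unfolding r_def .
qed

end
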